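(* Let $T>0$, $b\in\mathbb{R}\setminus\{0\}$, let $\varphi:\mathbb{R}\to\mathbb{R}$ be a homeomorphism with $\varphi(0)=0$, and let $f:[0,T]\times\mathbb{R}\times\mathbb{R}\to\mathbb{R}$ be continuous. Let $Z:[0,1]\times C^1\to C^1$ and $G:\mathbb{R}^2\to\mathbb{R}^2$ be the maps defined in the context. Assume that $\Omega$ is an open bounded set in $C^1$ such that the following conditions hold. 1. If $(\lambda,u)\in[0,1]\times C^1$ is such that $u=Z(\lambda,u)$, then $u\notin\partial\Omega$. 2. The Brouwer degree satisfies $\deg_B(G,\Omega\cap\mathbb{R}^2,0)\neq 0$, where $\mathbb{R}^2$ is identified with the subspace of $C^1$ of affine functions via $(x,y)\approx x+yt$. 3. For each $\lambda\in(0,1]$, the problem $$(\varphi(u'))'=\lambda N_f(u)+(1-\lambda)Q(N_f(u)),\quad u'(0)=u(0),\quad u'(T)=bu'(0)$$ has no solution on $\partial\Omega$. Then the problem $$(\varphi(u'))'=f(t,u,u'),\quad u'(0)=u(0),\quad u'(T)=bu'(0)$$ has a solution.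
   Context: $C=C([0,T],\mathbb{R})$ is the Banach space of continuous functions with norm $\|\cdot\|_\infty$, and $C^1=C^1([0,T],\mathbb{R})$ is the Banach space of continuously differentiable functions with norm $\|u\|_1=\|u\|_\infty+\|u'\|_\infty$. A solution of a boundary value problem of the form $(\varphi(u'))'=F(u)$ on $[0,T]$, $u'(0)=u(0)$, $u'(T)=bu'(0)$, where $F:C^1\to C$ (here $F(u)=f(\cdot,u,u')$ or $F(u)=\lambda N_f(u)+(1-\lambda)Q(N_f(u))$), is a function $u\in C^1$ such that $\varphi(u')$ is continuously differentiable, the differential equation holds for all $t\in[0,T]$, and the boundary conditions hold. Operators: $N_f:C^1\to C$, $N_f(u)(t)=f(t,u(t),u'(t))$; $H:C\to C^1$, $H(u)(t)=\int_0^t u(s)\,ds$; $Q:C\to C$, $Q(u)(t)=\frac1T\int_0^T u(s)\,ds$ (a constant function); $P:C\to C$, $P(u)(t)=u(0)$ (a constant function); $B_{\varphi,b}:\mathbb{R}\to\mathbb{R}$, $B_{\varphi,b}(x)=\varphi(bx)-\varphi(x)$; $\Psi(t)=t$; and $\varphi^{-1}:C\to C$ acts by $\varphi^{-1}(v)(t)=\varphi^{-1}(v(t))$. Constants are identified with constant functions. $$Z(\lambda,u)=P(u)+Q(N_f(u))-\frac{B_{\varphi,b}(Pu)}{T}+H\left(\varphi^{-1}\left[\lambda\frac{\Psi B_{\varphi,b}(Pu)}{T}+\varphi(Pu)\right]\right).$$ $$G(x,y)=\left(\frac{B_{\varphi,b}(x)}{T}-\frac1T\int_0^T f(t,x+yt,y)\,dt,\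 -x+y\right).$$ Under the identification, $\Omega\cap\mathbb{R}^2=\{(x,y)\in\mathbb{R}^2:\ \text{the function } t\mapsto x+yt \text{ belongs to }\Omega\}$. $\deg_B$ denotes the Brouwer degree. *)

theory Defs
  imports "HOL-Analysis.Analysis"
begin

section \<open>The function spaces on a compact interval\<close>

text \<open>
  The interval is a parameter, so functions on it are represented by elements of
  \<^term>\<open>extensional {0..T}\<close>: their values outside the interval are fixed, and equality of
  functions is equality on the interval. Derivatives are taken within the interval, hence
  one-sided at the end points.
\<close>

definition deriv_on :: "real \<Rightarrow> (real \<Rightarrow> real) \<Rightarrow> real \<Rightarrow> real" where
  "deriv_on T u = (\<lambda>t\<in>{0..T}. vector_derivative u (at t within {0..T}))"

definition C1_space :: "real \<Rightarrow> (real \<Rightarrow> real) set" where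
  "C1_space T = {u \<in> extensional {0..T}.
     u differentiable_on {0..T} \<and> continuous_on {0..T} (deriv_on T u)}"

definition sup_norm :: "real \<Rightarrow> (real \<Rightarrow> real) \<Rightarrow> real" where
  "sup_norm T u = (SUP t\<in>{0..T}. \<bar>u t\<bar>)"

definition C1_norm :: "real \<Rightarrow> (real \<Rightarrow> real) \<Rightarrow> real" where
  "C1_norm T u = sup_norm T u + sup_norm T (deriv_on T u)"

text \<open>The locale \<^locale>\<open>Metric_space\<close> asks for symmetry and nonnegativity on the whole
  type, which is why the distance is set to zero outside the space.\<close>

definition C1_dist :: "real \<Rightarrow> (real \<Rightarrow> real) \<Rightarrow> (real \<Rightarrow> real) \<Rightarrow> real" where
  "C1_dist T u v =
     (if u \<in> C1_space T \<and> v \<in> C1_space T then C1_norm T (\<lambda>t\<in>{0..T}. u t - v t) else 0)"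

abbreviation C1_topology :: "real \<Rightarrow> (real \<Rightarrow> real) topology" where
  "C1_topology T \<equiv> Metric_space.mtopology (C1_space T) (C1_dist T)"

abbreviation C1_bounded :: "real \<Rightarrow> (real \<Rightarrow> real) set \<Rightarrow> bool" where
  "C1_bounded T \<equiv> Metric_space.mbounded (C1_space T) (C1_dist T)"

lemma sup_norm_upper:
  assumes "continuous_on {0..T} u" "t \<in> {0..T}"
  shows "\<bar>u t\<bar> \<le> sup_norm T u"
proof -
  have "compact ((\<lambda>t. \<bar>u t\<bar>) ` {0..T})"
    by (intro compact_continuous_image continuous_intros assms) auto
  then have "bdd_above ((\<lambda>t. \<bar>u t\<bar>) ` {0..T})"
    by (intro bounded_imp_bdd_above compact_imp_bounded)
  then show ?thesis
    unfolding sup_norm_def using assms(2) by (intro cSUP_upper)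
qed

lemma sup_norm_least:
  assumes "0 < T" "\<And>t. t \<in> {0..T} \<Longrightarrow> \<bar>u t\<bar> \<le> c"
  shows "sup_norm T u \<le> c"
  unfolding sup_norm_def using assms by (intro cSUP_least) auto

lemma C1_space_has_deriv:
  assumes "u \<in> C1_space T" "t \<in> {0..T}"
  shows "(u has_vector_derivative deriv_on T u t) (at t within {0..T})"
  using assms
  by (auto simp: C1_space_def deriv_on_def differentiable_on_def vector_derivative_works)

lemma deriv_on_eqI:
  assumes "0 < T" "t \<in> {0..T}" "(u has_vector_derivative d) (at t within {0..T})"
  shows "deriv_on T u t = d"
  using vector_derivative_within_closed_interval[OF assms] assms(2) by (simp add: deriv_on_def)

lemma C1_space_continuous:
  assumes "u \<in> C1_space T"
  shows "continuous_on {0..T} u" "continuous_on {0..T} (deriv_on T u)"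
  using assms by (auto simp: C1_space_def differentiable_imp_continuous_on)

lemma C1_space_diff:
  assumes T: "0 < T" and u: "u \<in> C1_space T" and v: "v \<in> C1_space T"
  defines "w \<equiv> \<lambda>t\<in>{0..T}. u t - v t"
  shows "w \<in> C1_space T" and "\<And>t. t \<in> {0..T} \<Longrightarrow> deriv_on T w t = deriv_on T u t - deriv_on T v t"
proof -
  have hd: "(w has_vector_derivative (deriv_on T u t - deriv_on T v t)) (at t within {0..T})"
    if "t \<in> {0..T}" for t
    by (rule has_vector_derivative_transform[OF that _
          has_vector_derivative_diff[OF C1_space_has_deriv[OF u that] C1_space_has_deriv[OF v that]]])
       (simp add: w_def)
  show dw: "deriv_on T w t = deriv_on T u t - deriv_on T v t" if "t \<in> {0..T}" for t
    by (rule deriv_on_eqI[OF T that hd[OF that]])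
  have "continuous_on {0..T} (\<lambda>t. deriv_on T u t - deriv_on T v t)"
    by (intro continuous_intros C1_space_continuous u v)
  then have "continuous_on {0..T} (deriv_on T w)"
    by (rule continuous_on_eq) (simp add: dw)
  moreover have "w differentiable_on {0..T}"
    using hd unfolding differentiable_on_def differentiable_def has_vector_derivative_def by blast
  ultimately show "w \<in> C1_space T" by (simp add: C1_space_def w_def)
qed

lemma C1_Metric_space:
  assumes T: "0 < T"
  shows "Metric_space (C1_space T) (C1_dist T)"
proof
  let ?d = "\<lambda>u v. \<lambda>t\<in>{0..T}. u t - v t :: real"
  have 0: "0 \<in> {0..T}" using T by simp
  have pos: "0 \<le> sup_norm T u" if "continuous_on {0..T} u" for u
    using sup_norm_upper[OF that 0] by linarith
  have cont: "continuous_on {0..T} (?d u v)" "continuous_on {0..T} (deriv_on T (?d u v))"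
    if "u \<in> C1_space T" "v \<in> C1_space T" for u v
    using C1_space_continuous[OF C1_space_diff(1)[OF T that]] by auto
  have dd: "deriv_on T (?d u v) t = deriv_on T u t - deriv_on T v t"
    if "u \<in> C1_space T" "v \<in> C1_space T" "t \<in> {0..T}" for u v t
    by (rule C1_space_diff(2)[OF T that])
  show "0 \<le> C1_dist T u v" for u v
    using pos cont by (auto simp: C1_dist_def C1_norm_def intro!: add_nonneg_nonneg)
  show "C1_dist T u v = C1_dist T v u" for u v
  proof (cases "u \<in> C1_space T \<and> v \<in> C1_space T")
    case True
    have "sup_norm T (?d u v) = sup_norm T (?d v u)"
      unfolding sup_norm_def by (intro SUP_cong refl) (simp add: abs_minus_commute)
    moreover have "sup_norm T (deriv_on T (?d u v)) = sup_norm T (deriv_on T (?d v u))"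
      unfolding sup_norm_def by (intro SUP_cong refl) (use True in \<open>simp add: dd abs_minus_commute\<close>)
    ultimately show ?thesis by (simp add: C1_dist_def C1_norm_def)
  next
    case False
    then show ?thesis by (auto simp: C1_dist_def)
  qed
  show "C1_dist T u v = 0 \<longleftrightarrow> u = v" if uv: "u \<in> C1_space T" "v \<in> C1_space T" for u v
  proof
    assume "C1_dist T u v = 0"
    then have "sup_norm T (?d u v) = 0"
      using pos cont[OF uv] uv
      by (simp add: C1_dist_def C1_norm_def add_nonneg_eq_0_iff)
    then have "u t = v t" if "t \<in> {0..T}" for t
      using sup_norm_upper[OF cont(1)[OF uv] that] that by simp
    then show "u = v"
      using uv by (intro extensionalityI[of u "{0..T}" v]) (auto simp: C1_space_def)
  next
    assume "u = v"
    then have "sup_norm T (?d u v) \<le> 0" "sup_norm T (deriv_on T (?d u v)) \<le> 0"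
      using dd[OF uv] by (auto intro!: sup_norm_least[OF T])
    then show "C1_dist T u v = 0"
      using pos[OF cont(1)[OF uv]] pos[OF cont(2)[OF uv]] uv
      by (simp add: C1_dist_def C1_norm_def)
  qed
  show "C1_dist T u w \<le> C1_dist T u v + C1_dist T v w"
    if u: "u \<in> C1_space T" and v: "v \<in> C1_space T" and w: "w \<in> C1_space T" for u v w
  proof -
    have "sup_norm T (?d u w) \<le> sup_norm T (?d u v) + sup_norm T (?d v w)"
    proof (rule sup_norm_least[OF T])
      fix t assume t: "t \<in> {0..T}"
      show "\<bar>?d u w t\<bar> \<le> sup_norm T (?d u v) + sup_norm T (?d v w)"
        using sup_norm_upper[OF cont(1)[OF u v] t] sup_norm_upper[OF cont(1)[OF v w] t] t by simp
    qed
    moreover have "sup_norm T (deriv_on T (?d u w))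
        \<le> sup_norm T (deriv_on T (?d u v)) + sup_norm T (deriv_on T (?d v w))"
    proof (rule sup_norm_least[OF T])
      fix t assume t: "t \<in> {0..T}"
      show "\<bar>deriv_on T (?d u w) t\<bar>
          \<le> sup_norm T (deriv_on T (?d u v)) + sup_norm T (deriv_on T (?d v w))"
        using sup_norm_upper[OF cont(2)[OF u v] t] sup_norm_upper[OF cont(2)[OF v w] t]
        by (simp add: dd[OF u v t] dd[OF v w t] dd[OF u w t])
    qed
    ultimately show ?thesis using u v w by (simp add: C1_dist_def C1_norm_def)
  qed
qed


section \<open>The operators and the boundary value problem\<close>

definition N_op :: "real \<Rightarrow> (real \<Rightarrow> real \<Rightarrow> real \<Rightarrow> real) \<Rightarrow> (real \<Rightarrow> real) \<Rightarrow> real \<Rightarrow> real" where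
  "N_op T f u = (\<lambda>t\<in>{0..T}. f t (u t) (deriv_on T u t))"

definition H_op :: "real \<Rightarrow> (real \<Rightarrow> real) \<Rightarrow> real \<Rightarrow> real" where
  "H_op T u = (\<lambda>t\<in>{0..T}. integral {0..t} u)"

definition Q_op :: "real \<Rightarrow> (real \<Rightarrow> real) \<Rightarrow> real \<Rightarrow> real" where
  "Q_op T u = (\<lambda>t\<in>{0..T}. 1 / T * integral {0..T} u)"

definition P_op :: "real \<Rightarrow> (real \<Rightarrow> real) \<Rightarrow> real \<Rightarrow> real" where
  "P_op T u = (\<lambda>t\<in>{0..T}. u 0)"

definition B_fun :: "(real \<Rightarrow> real) \<Rightarrow> real \<Rightarrow> real \<Rightarrow> real" where
  "B_fun \<phi> b x = \<phi> (b * x) - \<phi> x"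

definition Z_op :: "real \<Rightarrow> real \<Rightarrow> (real \<Rightarrow> real) \<Rightarrow> (real \<Rightarrow> real \<Rightarrow> real \<Rightarrow> real) \<Rightarrow>
    real \<Rightarrow> (real \<Rightarrow> real) \<Rightarrow> real \<Rightarrow> real" where
  "Z_op T b \<phi> f lam u = (\<lambda>t\<in>{0..T}.
     P_op T u t + Q_op T (N_op T f u) t - B_fun \<phi> b (P_op T u t) / T
     + H_op T (\<lambda>s\<in>{0..T}. inv \<phi> (lam * (s * B_fun \<phi> b (P_op T u s) / T) + \<phi> (P_op T u s))) t)"

definition G_map :: "real \<Rightarrow> real \<Rightarrow> (real \<Rightarrow> real) \<Rightarrow> (real \<Rightarrow> real \<Rightarrow> real \<Rightarrow> real) \<Rightarrow>
    real^2 \<Rightarrow> real^2" where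
  "G_map T b \<phi> f v = vector
     [B_fun \<phi> b (v$1) / T - 1 / T * integral {0..T} (\<lambda>t. f t (v$1 + v$2 * t) (v$2)),
      - (v$1) + v$2]"

definition affine_slice :: "real \<Rightarrow> (real \<Rightarrow> real) set \<Rightarrow> (real^2) set" where
  "affine_slice T \<Omega> = {v. (\<lambda>t\<in>{0..T}. v$1 + v$2 * t) \<in> \<Omega>}"

definition bvp_solution :: "real \<Rightarrow> real \<Rightarrow> (real \<Rightarrow> real) \<Rightarrow>
    ((real \<Rightarrow> real) \<Rightarrow> real \<Rightarrow> real) \<Rightarrow> (real \<Rightarrow> real) \<Rightarrow> bool" where
  "bvp_solution T b \<phi> F u \<longleftrightarrow>
     u \<in> C1_space T \<and>
     (\<lambda>t\<in>{0..T}. \<phi> (deriv_on T u t)) \<in> C1_space T \<and>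
     (\<forall>t\<in>{0..T}. deriv_on T (\<lambda>s\<in>{0..T}. \<phi> (deriv_on T u s)) t = F u t) \<and>
     deriv_on T u 0 = u 0 \<and>
     deriv_on T u T = b * deriv_on T u 0"


section \<open>The Brouwer degree\<close>

text \<open>
  The usual analytic definition for an open bounded set \<open>D\<close>, a map \<open>f\<close> continuous on the closure
  of \<open>D\<close>, and a point \<open>p\<close> outside the image of the boundary: approximate \<open>f\<close>, more closely than the
  distance of \<open>p\<close> to the image of the boundary, by a map that is continuously differentiable
  in \<open>D\<close> and has \<open>p\<close> as a regular value, and count the preimages of \<open>p\<close> with the signs of the
  Jacobian determinant. By the classical theory such approximations exist and the count is finite
  and the same for all of them, so the choice made by \<open>SOME\<close> is immaterial. Where the degree is
  undefined in the literature, it is set to zero here.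
\<close>

definition regular_approx ::
    "(real^'n \<Rightarrow> real^'n) \<Rightarrow> (real^'n) set \<Rightarrow> real^'n \<Rightarrow> (real^'n \<Rightarrow> real^'n) \<Rightarrow> bool" where
  "regular_approx f D p g \<longleftrightarrow>
     continuous_on (closure D) g \<and>
     (\<exists>g' :: real^'n \<Rightarrow> (real^'n) \<Rightarrow>\<^sub>L (real^'n).
        continuous_on D g' \<and> (\<forall>x\<in>D. (g has_derivative blinfun_apply (g' x)) (at x))) \<and>
     (\<forall>x\<in>closure D. norm (g x - f x) < setdist {p} (f ` frontier D)) \<and>
     (\<forall>x\<in>D. g x = p \<longrightarrow> det (matrix (frechet_derivative g (at x))) \<noteq> 0)"

definition signed_count :: "(real^'n \<Rightarrow> real^'n) \<Rightarrow> (real^'n) set \<Rightarrow> real^'n \<Rightarrow> int" where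
  "signed_count g D p =
     (\<Sum>x | x \<in> D \<and> g x = p. if det (matrix (frechet_derivative g (at x))) > 0 then 1 else - 1)"

definition Brouwer_deg :: "(real^'n \<Rightarrow> real^'n) \<Rightarrow> (real^'n) set \<Rightarrow> real^'n \<Rightarrow> int" where
  "Brouwer_deg f D p =
     (if open D \<and> bounded D \<and> continuous_on (closure D) f \<and> p \<notin> f ` frontier D
      then signed_count (SOME g. regular_approx f D p g) D p
      else 0)"

end

theory Submission
  imports Defs "HOL-Complex_Analysis.Great_Picard"
begin

text \<open>
  The Leray--Schauder degree is avoided by shooting in the plane. Both homotopies, first
  \<open>u = Z(s, u)\<close> and then the boundary value problems with parameter \<open>\<lambda> = s - 1\<close>, have the form
  \<open>\<phi>(u'(t)) = \<phi>(x) + \<sigma> \<integral>\<^sub>0\<^sup>t f(q, u, u') dq + \<tau> t B(a) / T\<close>, \<open>u(0) = a\<close>, together with the two scalar equations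
  \<open>B(a) / T = Q(N\<^sub>f(u))\<close> and \<open>x = a\<close>. As \<open>f\<close> is only continuous, the initial value problem need not have
  a unique solution; replacing \<open>q\<close> by \<open>max 0 (q - h)\<close> in the arguments of \<open>u\<close> and \<open>u'\<close> makes it
  solvable by finitely many explicit steps, with continuous dependence on \<open>(a, x)\<close> and on the
  parameter. The two scalar equations then define a homotopy of planar maps that starts at \<open>G\<close>,
  on the planar domains of all \<open>(a, x)\<close> whose solution lies in \<open>\<Omega>\<close>. By the theorem of Arzela and
  Ascoli, limits for \<open>h \<rightarrow> 0\<close> solve the original problems, so for small \<open>h\<close> there are no zeros on
  the boundary, and a zero at the end of the homotopy is impossible if the boundary value problem
  has no solution.

  The planar degree is handled by comparing maps with regular zeros through the winding number
  along a large circle of the product of \<open>v - a\<close> or its conjugate over the zeros \<open>a\<close>.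
\<close>

section \<open>Regular approximations\<close>

text \<open>Sum and product rule keep the derivative continuous. It is a map into bounded linear
  functions because \<open>regular_approx\<close> asks for this form.\<close>

lemma real_polynomial_function_C1:
  fixes p :: "'a::euclidean_space \<Rightarrow> real"
  assumes "real_polynomial_function p"
  shows "\<exists>p' :: 'a \<Rightarrow> 'a \<Rightarrow>\<^sub>L real. continuous_on UNIV p' \<and>
           (\<forall>x. (p has_derivative blinfun_apply (p' x)) (at x))"
  using assms
proof (induction rule: real_polynomial_function.induct)
  case (linear h)
  then show ?case
    by (intro exI[of _ "\<lambda>_. Blinfun h"])
       (auto simp: bounded_linear_Blinfun_apply bounded_linear_imp_has_derivative)
next
  case (const c)
  then show ?case
    by (intro exI[of _ "\<lambda>_. 0"]) auto
next
  case (add p q)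
  then obtain p' q' where p': "continuous_on UNIV p'"
      "\<And>x. (p has_derivative blinfun_apply (p' x)) (at x)"
    and q': "continuous_on UNIV q'" "\<And>x. (q has_derivative blinfun_apply (q' x)) (at x)"
    by blast
  have "((\<lambda>x. p x + q x) has_derivative blinfun_apply (p' x + q' x)) (at x)" for x
    by (rule has_derivative_eq_rhs[OF has_derivative_add[OF p'(2) q'(2)]])
       (simp add: blinfun.add_left fun_eq_iff)
  moreover have "continuous_on UNIV (\<lambda>x. p' x + q' x)"
    by (intro continuous_intros p' q')
  ultimately show ?case by blast
next
  case (mult p q)
  then obtain p' q' where p': "continuous_on UNIV p'"
      "\<And>x. (p has_derivative blinfun_apply (p' x)) (at x)"
    and q': "continuous_on UNIV q'" "\<And>x. (q has_derivative blinfun_apply (q' x)) (at x)"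
    by blast
  have cont: "continuous_on UNIV p" "continuous_on UNIV q"
    using p'(2) q'(2) by (meson continuous_at_imp_continuous_on has_derivative_continuous)+
  have "((\<lambda>x. p x * q x) has_derivative blinfun_apply (p x *\<^sub>R q' x + q x *\<^sub>R p' x)) (at x)" for x
    by (rule has_derivative_eq_rhs[OF has_derivative_mult[OF p'(2) q'(2)]])
       (simp add: blinfun.add_left blinfun.scaleR_left fun_eq_iff algebra_simps)
  moreover have "continuous_on UNIV (\<lambda>x. p x *\<^sub>R q' x + q x *\<^sub>R p' x)"
    by (intro continuous_intros p' q' cont)
  ultimately show ?case by blast
qed

lemma polynomial_function_C1:
  fixes p :: "'a::euclidean_space \<Rightarrow> 'b::euclidean_space"
  assumes "polynomial_function p"
  shows "\<exists>p' :: 'a \<Rightarrow> 'a \<Rightarrow>\<^sub>L 'b. continuous_on UNIV p' \<and>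
           (\<forall>x. (p has_derivative blinfun_apply (p' x)) (at x))"
proof -
  have "\<forall>b\<in>Basis. \<exists>q :: 'a \<Rightarrow> 'a \<Rightarrow>\<^sub>L real. continuous_on UNIV q \<and>
           (\<forall>x. ((\<lambda>x. p x \<bullet> b) has_derivative blinfun_apply (q x)) (at x))"
    using assms real_polynomial_function_C1 polynomial_function_iff_Basis_inner by blast
  then obtain q :: "'b \<Rightarrow> 'a \<Rightarrow> 'a \<Rightarrow>\<^sub>L real" where
    q: "\<And>b. b \<in> Basis \<Longrightarrow> continuous_on UNIV (q b)"
       "\<And>b x. b \<in> Basis \<Longrightarrow> ((\<lambda>x. p x \<bullet> b) has_derivative blinfun_apply (q b x)) (at x)"
    by metis
  define p' where "p' x = (\<Sum>b\<in>Basis. blinfun_scaleR_left b o\<^sub>L q b x)" for x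
  have "continuous_on UNIV p'"
    unfolding p'_def
    by (intro continuous_on_sum bounded_bilinear.continuous_on[OF bounded_bilinear_blinfun_compose]
        continuous_on_const q)
  moreover have "(p has_derivative blinfun_apply (p' x)) (at x)" for x
  proof -
    have "(\<lambda>h. blinfun_apply (p' x) h \<bullet> b) = blinfun_apply (q b x)" if "b \<in> Basis" for b
      using that
      by (auto simp: p'_def blinfun.sum_left inner_sum_left inner_Basis fun_eq_iff if_distrib
          cong: if_cong)
    then show ?thesis
      using q(2) has_derivative_componentwise_within[of p "blinfun_apply (p' x)" x UNIV] by simp
  qed
  ultimately show ?thesis by blast
qed

text \<open>The part of \<open>regular_approx\<close> that does not mention \<open>f\<close>: one
  map \<open>g\<close> can then serve several maps \<open>f\<close> and several domains.\<close>

definition regular_C1 :: "(real^'n) set \<Rightarrow> real^'n \<Rightarrow> (real^'n \<Rightarrow> real^'n) \<Rightarrow> bool" where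
  "regular_C1 D p g \<longleftrightarrow>
     continuous_on (closure D) g \<and>
     (\<exists>g' :: real^'n \<Rightarrow> (real^'n) \<Rightarrow>\<^sub>L (real^'n).
        continuous_on D g' \<and> (\<forall>x\<in>D. (g has_derivative blinfun_apply (g' x)) (at x))) \<and>
     (\<forall>x\<in>D. g x = p \<longrightarrow> det (matrix (frechet_derivative g (at x))) \<noteq> 0)"

lemma regular_approx_iff:
  "regular_approx f D p g \<longleftrightarrow> regular_C1 D p g \<and>
     (\<forall>x\<in>closure D. norm (g x - f x) < setdist {p} (f ` frontier D))"
  unfolding regular_approx_def regular_C1_def by blast

lemma regular_C1_subset:
  assumes "regular_C1 D p g" "N \<subseteq> D"
  shows "regular_C1 N p g"
  using assms unfolding regular_C1_def
  by (meson closure_mono continuous_on_subset subsetD)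

text \<open>A polynomial from the Stone-Weierstrass theorem is shifted by a constant. By Sard's
  theorem its critical values are negligible, so an arbitrarily small shift makes \<open>p\<close> a
  regular value.\<close>

lemma regular_C1_dense:
  fixes f :: "real^'n::{finite,wellorder} \<Rightarrow> real^'n::{finite,wellorder}"
  assumes "bounded D" "continuous_on (closure D) f" "e > 0"
  obtains g where "regular_C1 D p g" "\<And>x. x \<in> closure D \<Longrightarrow> norm (g x - f x) < e"
proof -
  have "compact (closure D)"
    using assms(1) by (simp add: compact_closure)
  then obtain q where q: "polynomial_function q" "\<And>x. x \<in> closure D \<Longrightarrow> norm (f x - q x) < e/2"
    using Stone_Weierstrass_polynomial_function[of "closure D" f "e/2"] assms by auto
  obtain q' where q': "continuous_on UNIV q'"
      "\<And>x. (q has_derivative blinfun_apply (q' x)) (at x)"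
    using polynomial_function_C1[OF q(1)] by blast
  let ?C = "{x. det (matrix (blinfun_apply (q' x))) = 0}"
  have "negligible (q ` ?C)"
  proof (rule baby_Sard)
    show "(q has_derivative blinfun_apply (q' x)) (at x within ?C)" for x
      using q'(2) has_derivative_at_withinI by blast
    show "rank (matrix (blinfun_apply (q' x))) < CARD('n)" if "x \<in> ?C" for x
      using that by (simp add: det_eq_0_rank)
  qed simp
  \<comment> \<open>A ball is not negligible, so it contains a point \<open>y\<close> that is not a
    critical value. Subtracting \<open>y - p\<close> moves \<open>y\<close> to
    \<open>p\<close>.\<close>
  then have "\<not> ball p (e/2) \<subseteq> q ` ?C"
    using negligible_subset open_not_negligible[of "ball p (e/2)"] \<open>e > 0\<close> by auto
  then obtain y where y: "norm (y - p) < e/2" "y \<notin> q ` ?C"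
    unfolding subset_iff mem_ball dist_norm by (metis norm_minus_commute)
  define g where "g x = q x - (y - p)" for x
  have g': "(g has_derivative blinfun_apply (q' x)) (at x)" for x
    unfolding g_def using has_derivative_diff[OF q'(2)[of x] has_derivative_const[of "y - p"]] by simp
  have fd: "frechet_derivative g (at x) = blinfun_apply (q' x)" for x
    using frechet_derivative_at[OF g'] by simp
  show ?thesis
  proof
    have "continuous_on (closure D) g"
      using g' by (meson continuous_at_imp_continuous_on has_derivative_continuous)
    moreover have "det (matrix (frechet_derivative g (at x))) \<noteq> 0" if "g x = p" for x
      using y(2) that by (auto simp: fd g_def)
    ultimately show "regular_C1 D p g"
      using g' q'(1) unfolding regular_C1_def by (meson continuous_on_subset subset_UNIV)
    show "norm (g x - f x) < e" if "x \<in> closure D" for x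
    proof -
      have "norm (g x - f x) = norm ((f x - q x) + (y - p))"
        by (simp add: g_def norm_minus_commute algebra_simps)
      also have "\<dots> < e/2 + e/2"
        using q(2)[OF that] y(1) norm_triangle_ineq[of "f x - q x" "y - p"] by linarith
      finally show ?thesis by simp
    qed
  qed
qed

section \<open>Counting zeros of planar maps\<close>

definition plane :: "real^2 \<Rightarrow> complex" where
  "plane v = Complex (v$1) (v$2)"

lemma plane_simps [simp]:
  "plane (v + w) = plane v + plane w" "plane (v - w) = plane v - plane w"
  "plane 0 = 0" "norm (plane v) = norm v"
  by (auto simp: plane_def complex_eq_iff norm_complex_def norm_vec_def L2_set_def sum_2)

lemma plane_eq_iff [simp]: "plane v = plane w \<longleftrightarrow> v = w"
  by (auto simp: plane_def vec_eq_iff forall_2)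

lemma plane_eq_0_iff [simp]: "plane v = 0 \<longleftrightarrow> v = 0"
  using plane_eq_iff[of v 0] by simp

lemma continuous_on_plane [continuous_intros]:
  "continuous_on S f \<Longrightarrow> continuous_on S (\<lambda>x. plane (f x))"
  unfolding plane_def Complex_eq by (intro continuous_intros)

text \<open>Conjugation reverses orientation, so these are the model zeros of index 1 and
  -1.\<close>

definition zero_factor :: "bool \<Rightarrow> real^2 \<Rightarrow> real^2 \<Rightarrow> complex" where
  "zero_factor s a v = (if s then plane (v - a) else cnj (plane (v - a)))"

lemma zero_factor_eq_0_iff [simp]: "zero_factor s a v = 0 \<longleftrightarrow> v = a"
  by (simp add: zero_factor_def)

lemma norm_zero_factor [simp]: "norm (zero_factor s a v) = norm (v - a)"
  by (simp add: zero_factor_def del: plane_simps(2))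

lemma continuous_on_zero_factor [continuous_intros]:
  "continuous_on S f \<Longrightarrow> continuous_on S (\<lambda>x. zero_factor s a (f x))"
  unfolding zero_factor_def by (cases s; simp del: plane_simps; intro continuous_intros; simp)

text \<open>The truth value \<open>s\<close> records the orientation: near \<open>a\<close> the map behaves like a multiple of
  \<open>v - a\<close> or of its conjugate, up to a relative error less than \<open>1\<close>.\<close>

definition simple_zero :: "bool \<Rightarrow> real^2 \<Rightarrow> (real^2 \<Rightarrow> complex) \<Rightarrow> bool" where
  "simple_zero s a g \<longleftrightarrow> (\<exists>c \<theta>. c \<noteq> 0 \<and> \<theta> < 1 \<and>
     (\<forall>\<^sub>F v in at a. norm (c * (g v / zero_factor s a v) - 1) \<le> \<theta>))"

text \<open>A real linear map of the plane is \<open>\<alpha> * w + \<beta> * cnj w\<close> with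
  determinant \<open>|\<alpha>|^2 - |\<beta>|^2\<close>. The sign decides which term dominates;
  after division by that term the other one is a relative error below 1.\<close>

lemma simple_zero_if_derivative:
  fixes g :: "real^2 \<Rightarrow> real^2"
  assumes der: "(g has_derivative A) (at a)" and ga: "g a = 0" and det: "det (matrix A) \<noteq> 0"
  shows "simple_zero (det (matrix A) > 0) a (\<lambda>v. plane (g v))"
proof -
  define M where "M = matrix A"
  define \<alpha> where "\<alpha> = Complex ((M$1$1 + M$2$2)/2) ((M$2$1 - M$1$2)/2)"
  define \<beta> where "\<beta> = Complex ((M$1$1 - M$2$2)/2) ((M$2$1 + M$1$2)/2)"
  have "linear A" using der has_derivative_linear by blast
  then have "A w = M *v w" for w unfolding M_def by simp
  then have A: "plane (A w) = \<alpha> * plane w + \<beta> * cnj (plane w)" for w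
    by (simp add: plane_def complex_eq_iff \<alpha>_def \<beta>_def matrix_vector_mult_def sum_2 field_simps)
  have "det M = (norm \<alpha>)\<^sup>2 - (norm \<beta>)\<^sup>2"
    unfolding det_2 cmod_power2 by (simp add: \<alpha>_def \<beta>_def power2_eq_square field_simps)
  then have pos: "det M > 0 \<longleftrightarrow> norm \<beta> < norm \<alpha>" and neg: "det M < 0 \<longleftrightarrow> norm \<alpha> < norm \<beta>"
    by (simp_all add: power2_less_imp_less power_strict_mono abs_le_square_iff flip: not_le)
  define s where "s \<longleftrightarrow> det M > 0"
  define c where "c = (if s then \<alpha> else \<beta>)"
  define d where "d = (if s then \<beta> else \<alpha>)"
  have cd: "norm d < norm c"
    using pos neg det unfolding c_def d_def s_def M_def[symmetric] by auto
  have zf: "zero_factor (\<not> s) a v = cnj (zero_factor s a v)" for v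
    by (simp add: zero_factor_def)
  have A': "plane (A (v - a)) = c * zero_factor s a v + d * zero_factor (\<not> s) a v" for v
    unfolding A by (simp add: zero_factor_def c_def d_def)
  have c0: "c \<noteq> 0" using cd by auto
  \<comment> \<open>Half of the gap between the coefficients is left for the remainder of the
    derivative, so that \<open>(norm d + \<eta>) / norm c\<close> is still below 1.\<close>
  define \<eta> where "\<eta> = (norm c - norm d) / 2"
  have "\<eta> > 0" using cd by (simp add: \<eta>_def)
  have "((\<lambda>v. (1 / norm (v - a)) *\<^sub>R (g v - (g a + A (v - a)))) \<longlongrightarrow> 0) (at a)"
    using der by (simp add: has_derivative_within)
  then have "\<forall>\<^sub>F v in at a. dist ((1 / norm (v - a)) *\<^sub>R (g v - (g a + A (v - a)))) 0 < \<eta>"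
    using \<open>\<eta> > 0\<close> by (rule tendstoD)
  then have "\<forall>\<^sub>F v in at a. norm (inverse c * (plane (g v) / zero_factor s a v) - 1)
      \<le> (norm d + \<eta>) / norm c"
    using eventually_neq_at_within[of a a UNIV]
  proof eventually_elim
    case (elim v)
    then have "norm (g v - A (v - a)) \<le> \<eta> * norm (v - a)"
      by (simp add: ga divide_simps split: if_splits)
    then have 1: "norm (plane (g v) - plane (A (v - a))) \<le> \<eta> * norm (v - a)"
      using plane_simps(2,4) by metis
    have "norm (plane (g v) - c * zero_factor s a v)
        = norm ((plane (g v) - plane (A (v - a))) + d * zero_factor (\<not> s) a v)"
      by (simp only: A') simp
    also have "\<dots> \<le> \<eta> * norm (v - a) + norm d * norm (v - a)"
      by (rule order_trans[OF norm_triangle_ineq]) (use 1 in \<open>simp add: norm_mult\<close>)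
    finally have 2: "norm (plane (g v) - c * zero_factor s a v) \<le> (norm d + \<eta>) * norm (v - a)"
      by (simp add: algebra_simps)
    have "norm (inverse c * (plane (g v) / zero_factor s a v) - 1)
        = norm ((plane (g v) - c * zero_factor s a v) / (c * zero_factor s a v))"
      using c0 elim by (simp add: divide_simps)
    also have "\<dots> = norm (plane (g v) - c * zero_factor s a v) / (norm c * norm (v - a))"
      by (simp add: norm_divide norm_mult)
    also have "\<dots> \<le> (norm d + \<eta>) * norm (v - a) / (norm c * norm (v - a))"
      by (intro divide_right_mono 2) simp
    finally show ?case using elim by simp
  qed
  moreover have "(norm d + \<eta>) / norm c < 1"
    using cd c0 by (subst divide_less_eq_1_pos) (auto simp: \<eta>_def field_simps)
  ultimately show ?thesis
    unfolding simple_zero_def s_def[symmetric, unfolded M_def]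
    using c0 by (intro exI[of _ "inverse c"] exI) auto
qed

text \<open>Each simple zero is divided out by its factor; the quotient is bounded away from \<open>0\<close> and
  lies in a half plane near the zero, so it can be interpolated with a constant there.\<close>

lemma remove_simple_zeros:
  fixes g :: "real^2 \<Rightarrow> complex"
  assumes "open D" "D \<subseteq> K" "finite Z" "Z \<subseteq> D"
    and "continuous_on K g" "{v\<in>K. g v = 0} = Z" "\<And>a. a \<in> Z \<Longrightarrow> simple_zero (s a) a g"
  shows "\<exists>m. continuous_on K m \<and> (\<forall>v\<in>K. m v \<noteq> 0) \<and>
           (\<forall>v\<in>K - D. g v = m v * (\<Prod>a\<in>Z. zero_factor (s a) a v))"
  using assms(3-)
proof (induction Z arbitrary: g rule: finite_induct)
  case empty
  then show ?case by (intro exI[of _ g]) auto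
next
  case (insert a Z)
  have aK: "a \<in> K" and aD: "a \<in> D" using insert.prems assms(2) by auto
  obtain c \<theta> where c: "c \<noteq> 0" "\<theta> < 1"
    and ev: "\<forall>\<^sub>F v in at a. norm (c * (g v / zero_factor (s a) a v) - 1) \<le> \<theta>"
    using insert.prems(4)[of a] unfolding simple_zero_def by auto
  have "\<forall>\<^sub>F v in at a. v \<in> D - Z"
    using assms(1) aD insert.hyps by (intro eventually_at_in_open') (auto intro: finite_imp_closed)
  with ev obtain r where r: "r > 0" and
    r': "\<And>v. v \<noteq> a \<Longrightarrow> dist v a < r \<Longrightarrow>
       norm (c * (g v / zero_factor (s a) a v) - 1) \<le> \<theta> \<and> v \<in> D - Z"
    unfolding eventually_at by (metis (no_types, lifting) UNIV_I dist_commute ev eventually_at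
        eventually_conj min_less_iff_conj zero_less_dist_iff)
  define \<rho> where "\<rho> = r/2"
  have \<rho>: "\<rho> > 0" using r by (simp add: \<rho>_def)
  have near: "norm (c * (g v / zero_factor (s a) a v) - 1) \<le> \<theta>" "v \<in> D" "v \<notin> Z"
    if "v \<noteq> a" "dist v a \<le> \<rho>" for v
    using r'[of v] that r by (auto simp: \<rho>_def)
  \<comment> \<open>The weight is 0 at \<open>a\<close> and 1 from distance \<open>\<rho>\<close>
    on, so \<open>g1\<close> runs from \<open>1 / c\<close> at \<open>a\<close> to the quotient
    \<open>h\<close>. At \<open>a\<close> itself \<open>h\<close> has the default value of a
    division by 0, which the weight 0 removes.\<close>
  define \<xi> where "\<xi> v = min 1 (dist v a / \<rho>)" for v
  define h where "h v = g v / zero_factor (s a) a v" for v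
  define g1 where "g1 v = of_real (\<xi> v) * h v + of_real (1 - \<xi> v) / c" for v
  have \<xi>: "0 \<le> \<xi> v" "\<xi> v \<le> 1" for v
    using \<rho> by (auto simp: \<xi>_def)
  have \<xi>1: "\<xi> v = 1" if "dist v a \<ge> \<rho>" for v
    using that \<rho> by (simp add: \<xi>_def)
  have g1_far: "g1 v = h v" if "dist v a \<ge> \<rho>" for v
    using \<xi>1[OF that] by (simp add: g1_def)
  \<comment> \<open>The deviation from 1 is only scaled by \<open>\<xi>\<close>: near
    \<open>a\<close> it stays at most \<open>\<theta>\<close>, so \<open>g1\<close> does not vanish,
    and it tends to 0 at \<open>a\<close>, so \<open>g1\<close> is continuous there.\<close>
  have cg1: "c * g1 v - 1 = of_real (\<xi> v) * (c * h v - 1)" for v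
    using c(1) by (simp add: g1_def field_simps)
  have cg1_le: "norm (c * g1 v - 1) \<le> \<xi> v * 1" if "dist v a \<le> \<rho>" for v
  proof (cases "v = a")
    case False
    then have "norm (c * h v - 1) \<le> 1"
      using near(1)[OF False that] c(2) by (simp add: h_def)
    then show ?thesis
      unfolding cg1 norm_mult using \<xi>[of v] by (simp add: mult_left_le)
  qed (simp add: cg1 \<xi>_def)
  have g1_near: "g1 v \<noteq> 0" if "dist v a \<le> \<rho>" for v
  proof
    assume 0: "g1 v = 0"
    show False
    proof (cases "v = a")
      case True
      then show False using 0 c(1) by (simp add: g1_def \<xi>_def)
    next
      case False
      have "norm (c * g1 v - 1) \<le> 1 * \<theta>"
        unfolding cg1 norm_mult using near(1)[OF False that] \<xi>[of v]
        by (intro mult_mono) (auto simp: h_def)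
      then show False using 0 c(2) by simp
    qed
  qed
  have conth: "continuous_on (K - {a}) h"
    unfolding h_def
    by (intro continuous_intros continuous_on_subset[OF insert.prems(2)]) auto
  have cont\<xi>: "continuous_on A \<xi>" for A
    unfolding \<xi>_def by (intro continuous_intros) (use \<rho> in auto)
  have "continuous_on K g1"
  proof -
    have 1: "continuous_on (K - {a}) g1"
      unfolding g1_def using c(1)
      by (intro continuous_intros conth cont\<xi>) auto
    have 2: "(g1 \<longlongrightarrow> g1 a) (at a within K)"
    proof -
      have g1a: "g1 a = 1 / c" by (simp add: g1_def \<xi>_def)
      have "(\<xi> \<longlongrightarrow> \<xi> a) (at a within K)"
        using cont\<xi>[of K] aK by (auto simp: continuous_on_def)
      then have "(\<xi> \<longlongrightarrow> 0) (at a within K)" by (simp add: \<xi>_def)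
      moreover have "\<forall>\<^sub>F v in at a within K. norm (c * g1 v - 1) \<le> \<xi> v"
        unfolding eventually_at using \<rho> cg1_le by (intro exI[of _ \<rho>]) (auto simp: dist_commute)
      ultimately have "((\<lambda>v. c * g1 v - 1) \<longlongrightarrow> 0) (at a within K)"
        by (rule Lim_null_comparison[rotated])
      then have "((\<lambda>v. (c * g1 v - 1 + 1) / c) \<longlongrightarrow> (0 + 1) / c) (at a within K)"
        by (intro tendsto_intros c)
      then show ?thesis using c(1) g1a by simp
    qed
    show ?thesis
      unfolding continuous_on_def
    proof
      fix v assume v: "v \<in> K"
      show "(g1 \<longlongrightarrow> g1 v) (at v within K)"
      proof (cases "v = a")
        case False
        have "at v within (K - {a}) = at v within K"
          using False by (intro at_within_nhd[of _ "- {a}"]) auto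
        moreover have "(g1 \<longlongrightarrow> g1 v) (at v within (K - {a}))"
          using 1 False v unfolding continuous_on_def by blast
        ultimately show ?thesis by simp
      qed (use 2 in simp)
    qed
  qed
  moreover have "{v\<in>K. g1 v = 0} = Z"
  proof -
    have "g1 v = 0 \<longleftrightarrow> v \<in> Z" if "v \<in> K" for v
    proof (cases "dist v a \<le> \<rho>")
      case True
      then show ?thesis using g1_near near(3) insert.hyps(2) by (cases "v = a") auto
    next
      case False
      then have "v \<noteq> a" "g1 v = h v" using g1_far \<rho> by auto
      then show ?thesis using that insert.prems(3) by (auto simp: h_def)
    qed
    moreover have "Z \<subseteq> K" using insert.prems(3) by auto
    ultimately show ?thesis by auto
  qed
  moreover have "simple_zero (s z) z g1" if z: "z \<in> Z" for z
  proof -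
    have za: "z \<noteq> a" using z insert.hyps by auto
    have dz: "dist z a > \<rho>" using near(3)[OF za] z by force
    obtain d \<eta> where d: "d \<noteq> 0" "\<eta> < 1"
      and ev: "\<forall>\<^sub>F v in at z. norm (d * (g v / zero_factor (s z) z v) - 1) \<le> \<eta>"
      using insert.prems(4)[of z] z unfolding simple_zero_def by auto
    \<comment> \<open>Near another zero \<open>z\<close> the map \<open>g1\<close> is
      \<open>g\<close> divided by the factor of \<open>a\<close>, which is almost constant there. As
      \<open>q\<close> tends to 1, the error bound \<open>\<eta>\<close> grows at most to
      \<open>(1 + \<eta>) / 2\<close>, still below 1.\<close>
    define q where "q v = zero_factor (s a) a z / zero_factor (s a) a v" for v
    have qz: "q z = 1" using za by (simp add: q_def)
    have "continuous_on (- {a}) q"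
      unfolding q_def by (intro continuous_intros) auto
    then have "(q \<longlongrightarrow> q z) (at z)"
      using za by (metis Compl_iff continuous_on_def at_within_open open_delete open_UNIV
          Compl_eq_Diff_UNIV singletonD)
    then have lim: "((\<lambda>v. norm (q v) * \<eta> + norm (q v - 1)) \<longlongrightarrow> norm (q z) * \<eta> + norm (q z - 1)) (at z)"
      by (intro tendsto_intros)
    have "\<forall>\<^sub>F v in at z. norm (q v) * \<eta> + norm (q v - 1) < (1 + \<eta>) / 2"
      by (rule order_tendstoD(2)[OF lim]) (use qz d in simp)
    moreover have "\<forall>\<^sub>F v in at z. v \<in> - cball a \<rho>"
      using dz by (intro eventually_at_in_open') (auto simp: dist_commute)
    ultimately have "\<forall>\<^sub>F v in at z. norm (d * zero_factor (s a) a z * (g1 v / zero_factor (s z) z v) - 1)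
        \<le> (1 + \<eta>) / 2"
      using ev
    proof eventually_elim
      case (elim v)
      then have "g1 v = h v" using g1_far[of v] by (simp add: dist_commute)
      then have "d * zero_factor (s a) a z * (g1 v / zero_factor (s z) z v) - 1
         = q v * (d * (g v / zero_factor (s z) z v) - 1) + (q v - 1)"
        by (simp add: h_def q_def right_diff_distrib mult_ac)
      also have "norm \<dots> \<le> norm (q v) * norm (d * (g v / zero_factor (s z) z v) - 1) + norm (q v - 1)"
        by (metis norm_mult norm_triangle_ineq)
      also have "\<dots> \<le> norm (q v) * \<eta> + norm (q v - 1)"
        by (intro add_right_mono mult_left_mono elim) auto
      finally show ?case using elim by linarith
    qed
    moreover have "d * zero_factor (s a) a z \<noteq> 0" "(1 + \<eta>) / 2 < 1" using d za by auto
    ultimately show ?thesis unfolding simple_zero_def by blast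
  qed
  ultimately obtain m where m: "continuous_on K m" "\<And>v. v \<in> K \<Longrightarrow> m v \<noteq> 0"
      "\<And>v. v \<in> K - D \<Longrightarrow> g1 v = m v * (\<Prod>a\<in>Z. zero_factor (s a) a v)"
    using insert.IH[of g1] insert.prems(1) by blast
  have "g v = m v * (\<Prod>a\<in>insert a Z. zero_factor (s a) a v)" if v: "v \<in> K - D" for v
  proof -
    have "v \<noteq> a" using v aD by auto
    then have "dist v a > \<rho>" using near(2) v by force
    then have "g v = g1 v * zero_factor (s a) a v"
      using g1_far[of v] \<open>v \<noteq> a\<close> by (simp add: h_def)
    then show ?thesis using m(3)[OF v] insert.hyps by (simp add: mult_ac)
  qed
  then show ?case using m by blast
qed

section \<open>Winding numbers along large circles\<close>

definition circ :: "real \<Rightarrow> real \<Rightarrow> real^2" where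
  "circ R t = vector [R * cos t, R * sin t]"

lemma plane_circ: "plane (circ R t) = of_real R * exp (\<i> * of_real t)"
  by (simp add: plane_def circ_def complex_eq_iff flip: cis_conv_exp)

lemma continuous_on_circ [continuous_intros]: "continuous_on S (circ R)"
proof -
  have "circ R = (\<lambda>t. \<chi> i. if i = 1 then R * cos t else R * sin t)"
    by (auto simp: circ_def vec_eq_iff forall_2 fun_eq_iff)
  then show ?thesis
    by (simp, intro continuous_on_vec_lambda)
       (rename_tac i, case_tac "i = 1", auto intro!: continuous_intros)
qed

lemma norm_circ: "norm (circ R t) = \<bar>R\<bar>"
proof -
  have "norm (circ R t) = norm (plane (circ R t))" by simp
  also have "\<dots> = \<bar>R\<bar>" by (simp add: plane_circ norm_mult)
  finally show ?thesis .
qed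

text \<open>With \<open>w = plane (circ R t)\<close>,
  \<open>w - plane a = w * (1 - plane a / w)\<close>, and the second factor lies in the right half
  plane, where \<open>Ln\<close> is continuous. As \<open>k\<close> agrees at 0 and
  \<open>2 * pi\<close>, the winding comes from the linear term alone; conjugation changes its
  sign.\<close>

lemma zero_factor_circ:
  assumes "norm a < R"
  shows "\<exists>k. continuous_on UNIV k \<and> k (2 * pi) = k 0 \<and>
    (\<forall>t. zero_factor s a (circ R t) = exp (\<i> * of_real (if s then t else - t) + k t))"
proof -
  have R: "R > 0" using assms norm_ge_zero[of a] by linarith
  define l where "l t = of_real (ln R) + Ln (1 - plane a / plane (circ R t))" for t
  have nz: "plane (circ R t) \<noteq> 0" for t using R by (simp add: plane_circ)
  have small: "norm (plane a / plane (circ R t)) < 1" for t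
    using assms R by (simp add: norm_divide norm_circ del: plane_eq_0_iff)
  have half: "Re (1 - plane a / plane (circ R t)) > 0" for t
    using small[of t] complex_Re_le_cmod[of "plane a / plane (circ R t)"] by simp
  have contl: "continuous_on UNIV l"
    unfolding l_def using nz half
    by (intro continuous_intros) (auto simp: complex_nonpos_Reals_iff not_le)
  have per: "l (2 * pi) = l 0" by (simp add: l_def circ_def)
  have eq: "plane (circ R t - a) = exp (\<i> * of_real t + l t)" for t
  proof -
    have "1 - plane a / plane (circ R t) \<noteq> 0" using half[of t] by fastforce
    then have "exp (\<i> * of_real t + l t)
        = exp (\<i> * of_real t) * (of_real (exp (ln R)) * (1 - plane a / plane (circ R t)))"
      by (simp add: l_def exp_add exp_of_real)
    also have "\<dots> = plane (circ R t) * (1 - plane a / plane (circ R t))"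
      using R by (simp add: plane_circ mult_ac)
    finally show ?thesis using nz[of t] by (simp add: field_simps)
  qed
  show ?thesis
  proof (cases s)
    case True
    then show ?thesis using contl per eq by (auto simp: zero_factor_def simp del: plane_simps)
  next
    case False
    have "cnj (plane (circ R t - a)) = exp (\<i> * of_real (- t) + cnj (l t))" for t
      unfolding eq exp_cnj by simp
    then show ?thesis using False contl per
      by (intro exI[of _ "\<lambda>t. cnj (l t)"])
         (auto simp: zero_factor_def simp del: plane_simps intro: continuous_on_cnj)
  qed
qed

text \<open>Logarithms of the factors add up, so the sum of the signs is the winding number of the
  product.\<close>

lemma prod_zero_factor_circ:
  assumes "finite Z" "\<And>a. a \<in> Z \<Longrightarrow> norm a < R"
  shows "\<exists>k. continuous_on UNIV k \<and> k (2 * pi) = k 0 \<and>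
    (\<forall>t. (\<Prod>a\<in>Z. zero_factor (s a) a (circ R t)) =
       exp (\<i> * of_real (of_int (\<Sum>a\<in>Z. if s a then 1 else - 1) * t) + k t))"
  using assms
proof (induction Z rule: finite_induct)
  case empty
  then show ?case by (intro exI[of _ "\<lambda>_. 0"]) auto
next
  case (insert a Z)
  then obtain k where k: "continuous_on UNIV k" "k (2 * pi) = k 0"
    "\<And>t. (\<Prod>a\<in>Z. zero_factor (s a) a (circ R t)) =
       exp (\<i> * of_real (of_int (\<Sum>a\<in>Z. if s a then 1 else - 1) * t) + k t)" by auto
  obtain l where l: "continuous_on UNIV l" "l (2 * pi) = l 0"
    "\<And>t. zero_factor (s a) a (circ R t) = exp (\<i> * of_real (if s a then t else - t) + l t)"
    using zero_factor_circ[of a R "s a"] insert.prems by auto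
  show ?case
    using insert.hyps
    by (intro exI[of _ "\<lambda>t. k t + l t"] conjI allI continuous_intros k(1) l(1))
       (auto simp: k(2,3) l(2,3) exp_add[symmetric] ring_distribs add_ac)
qed

text \<open>After division by the zero factors, \<open>g1 / g2\<close> is continuous and nonvanishing on the closure
  of \<open>D\<close>, and since it has a logarithm on the frontier it extends over the whole plane, as the
  quotient of the zero factors outside \<open>D\<close>. An entire logarithm forces its winding number along a
  large circle, which is the difference of the two sums, to vanish.\<close>

lemma sum_signs_eq:
  fixes g1 g2 :: "real^2 \<Rightarrow> complex"
  assumes D: "open D" "bounded D"
    and g1: "continuous_on (closure D) g1" "finite {v\<in>closure D. g1 v = 0}"
      "{v\<in>closure D. g1 v = 0} \<subseteq> D"
      "\<And>a. a \<in> D \<Longrightarrow> g1 a = 0 \<Longrightarrow> simple_zero (s1 a) a g1"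
    and g2: "continuous_on (closure D) g2" "finite {v\<in>closure D. g2 v = 0}"
      "{v\<in>closure D. g2 v = 0} \<subseteq> D"
      "\<And>a. a \<in> D \<Longrightarrow> g2 a = 0 \<Longrightarrow> simple_zero (s2 a) a g2"
    and quot: "\<And>v. v \<in> frontier D \<Longrightarrow> g1 v / g2 v \<notin> \<real>\<^sub>\<le>\<^sub>0"
  shows "(\<Sum>a | a \<in> D \<and> g1 a = 0. if s1 a then 1 else - 1 :: int) =
         (\<Sum>a | a \<in> D \<and> g2 a = 0. if s2 a then 1 else - 1)"
proof -
  define Z1 where "Z1 = {v\<in>closure D. g1 v = 0}"
  define Z2 where "Z2 = {v\<in>closure D. g2 v = 0}"
  have Z1: "{a. a \<in> D \<and> g1 a = 0} = Z1" and Z2: "{a. a \<in> D \<and> g2 a = 0} = Z2"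
    using g1(3) g2(3) closure_subset by (auto simp: Z1_def Z2_def)
  have fin: "finite Z1" "finite Z2" and sub: "Z1 \<subseteq> D" "Z2 \<subseteq> D"
    using g1 g2 by (auto simp: Z1_def Z2_def)
  have fr: "closure D - D = frontier D" using D(1) by (simp add: frontier_def interior_open)
  define P1 where "P1 v = (\<Prod>a\<in>Z1. zero_factor (s1 a) a v)" for v
  define P2 where "P2 v = (\<Prod>a\<in>Z2. zero_factor (s2 a) a v)" for v
  obtain m1 where m1: "continuous_on (closure D) m1" "\<And>v. v \<in> closure D \<Longrightarrow> m1 v \<noteq> 0"
    "\<And>v. v \<in> frontier D \<Longrightarrow> g1 v = m1 v * P1 v"
    using remove_simple_zeros[OF D(1) closure_subset fin(1) sub(1) g1(1), of s1] g1(4) sub(1)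
    unfolding fr P1_def Z1_def by blast
  obtain m2 where m2: "continuous_on (closure D) m2" "\<And>v. v \<in> closure D \<Longrightarrow> m2 v \<noteq> 0"
    "\<And>v. v \<in> frontier D \<Longrightarrow> g2 v = m2 v * P2 v"
    using remove_simple_zeros[OF D(1) closure_subset fin(2) sub(2) g2(1), of s2] g2(4) sub(2)
    unfolding fr P2_def Z2_def by blast
  have P0: "P1 v \<noteq> 0" "P2 v \<noteq> 0" if "v \<notin> D" for v
    using that sub fin by (auto simp: P1_def P2_def)
  have contP: "continuous_on A P1" "continuous_on A P2" for A
    unfolding P1_def P2_def by (intro continuous_intros; simp)+
  have frc: "frontier D \<subseteq> closure D" by (simp add: frontier_def)
  have "g2 v \<noteq> 0" if "v \<in> frontier D" for v
    using quot[OF that] by force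
  then have "continuous_on (frontier D) (\<lambda>v. Ln (g1 v / g2 v))"
    using quot by (intro continuous_intros continuous_on_subset[OF g1(1) frc]
        continuous_on_subset[OF g2(1) frc]) auto
  then obtain l where l: "continuous_on UNIV l" "\<And>v. v \<in> frontier D \<Longrightarrow> l v = Ln (g1 v / g2 v)"
    using Tietze_unbounded[of "frontier D" _ UNIV] by auto
  \<comment> \<open>On the frontier
    \<open>exp (l v) = g1 v / g2 v = m1 v * P1 v / (m2 v * P2 v)\<close>, so the two branches agree
    there.\<close>
  define E where "E v = (if v \<in> closure D then m1 v / (m2 v * exp (l v)) else P2 v / P1 v)" for v
  have "continuous_on (closure D \<union> - D) E"
    unfolding E_def
  proof (rule continuous_on_cases)
    show "closed (closure D)" "closed (- D)" using D by auto
    show "continuous_on (closure D) (\<lambda>v. m1 v / (m2 v * exp (l v)))"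
      using m2(2) by (intro continuous_intros m1 m2 continuous_on_subset[OF l(1)]) auto
    show "continuous_on (- D) (\<lambda>v. P2 v / P1 v)"
      using P0 by (intro continuous_intros contP) auto
    show "\<forall>v. v \<in> closure D \<and> v \<notin> closure D \<or> v \<in> - D \<and> v \<in> closure D \<longrightarrow>
        m1 v / (m2 v * exp (l v)) = P2 v / P1 v"
    proof (intro allI impI)
      fix v assume "v \<in> closure D \<and> v \<notin> closure D \<or> v \<in> - D \<and> v \<in> closure D"
      then have v: "v \<in> frontier D" "v \<notin> D" "v \<in> closure D" using fr by auto
      have "exp (l v) = g1 v / g2 v"
        using quot[OF v(1)] l(2)[OF v(1)] by (metis exp_Ln nonpos_Reals_zero_I)
      then show "m1 v / (m2 v * exp (l v)) = P2 v / P1 v"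
        using m1(2,3) m2(2,3) v P0[OF v(2)] by (simp add: field_simps)
    qed
  qed
  moreover have "closure D \<union> - D = UNIV" using closure_subset[of D] by auto
  ultimately have "continuous_on UNIV E" by simp
  moreover have "E v \<noteq> 0" for v
    using m1(2)[of v] m2(2)[of v] P0[of v] closure_subset[of D] by (auto simp: E_def)
  ultimately obtain L where L: "continuous_on UNIV L" "\<And>v. E v = exp (L v)"
    using continuous_logarithm_on_contractible[of UNIV E] convex_imp_contractible[of "UNIV::(real^2) set"]
    by auto
  obtain R where R: "\<And>v. v \<in> closure D \<Longrightarrow> norm v < R"
    using D(2) bounded_closure[of D] unfolding bounded_pos_less by metis
  have clR: "norm a < R" if "a \<in> Z1 \<union> Z2" for a
    using R[of a] that sub closure_subset[of D] by auto
  \<comment> \<open>The maximum with 1 makes the radius positive, so the circle has radius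
    \<open>R'\<close> and lies outside the closure of \<open>D\<close>.\<close>
  define R' where "R' = max R 1"
  define N1 :: int where "N1 = (\<Sum>a\<in>Z1. if s1 a then 1 else - 1)"
  define N2 :: int where "N2 = (\<Sum>a\<in>Z2. if s2 a then 1 else - 1)"
  obtain k1 where k1: "continuous_on UNIV k1" "k1 (2 * pi) = k1 0"
      "\<And>t. P1 (circ R' t) = exp (\<i> * of_real (of_int N1 * t) + k1 t)"
    using prod_zero_factor_circ[OF fin(1), of R' s1] clR unfolding P1_def N1_def R'_def by fastforce
  obtain k2 where k2: "continuous_on UNIV k2" "k2 (2 * pi) = k2 0"
      "\<And>t. P2 (circ R' t) = exp (\<i> * of_real (of_int N2 * t) + k2 t)"
    using prod_zero_factor_circ[OF fin(2), of R' s2] clR unfolding P2_def N2_def R'_def by fastforce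
  \<comment> \<open>On the circle this is a logarithm of \<open>E * P1 / P2 = 1\<close>. It takes
    discrete values, hence is constant, and only its linear term could differ between 0 and
    \<open>2 * pi\<close>.\<close>
  define J where "J t = L (circ R' t) + \<i> * of_real (of_int (N1 - N2) * t) + (k1 t - k2 t)" for t
  have contJ: "continuous_on UNIV J"
    unfolding J_def
    by (intro continuous_intros k1 k2 continuous_on_compose2[OF L(1) continuous_on_circ]) auto
  have expJ: "exp (J t) = 1" for t
  proof -
    have "circ R' t \<notin> closure D"
      using R[of "circ R' t"] by (auto simp: norm_circ R'_def)
    then have "circ R' t \<notin> D" "E (circ R' t) = P2 (circ R' t) / P1 (circ R' t)"
      using closure_subset[of D] by (auto simp: E_def)
    then have "exp (L (circ R' t)) * P1 (circ R' t) = P2 (circ R' t)"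
      using P0(1)[of "circ R' t"] by (simp flip: L(2))
    moreover have "exp (J t) = exp (L (circ R' t)) * P1 (circ R' t) / P2 (circ R' t)"
      by (simp add: J_def k1 k2 exp_add exp_diff ring_distribs)
    moreover have "P2 (circ R' t) \<noteq> 0" by (simp add: k2)
    ultimately show ?thesis by simp
  qed
  have "J constant_on UNIV"
  proof (rule continuous_discrete_range_constant[OF connected_UNIV contJ])
    fix t :: real
    have "1 \<le> norm (J y - J t)" if ne: "J y \<noteq> J t" for y
    proof -
      have "exp (J y) = exp (J t)" using expJ by simp
      then obtain n :: int where n: "J y = J t + of_int (2 * n) * pi * \<i>"
        unfolding exp_eq by auto
      then have "n \<noteq> 0" using ne by auto
      then have "\<bar>of_int n\<bar> \<ge> (1::real)" by linarith
      have "norm (J y - J t) = 2 * \<bar>of_int n\<bar> * pi"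
        using n by (simp add: norm_mult)
      also have "\<dots> \<ge> 2 * 1 * 1"
        using \<open>\<bar>of_int n\<bar> \<ge> (1::real)\<close> pi_ge_two by (intro mult_mono) auto
      finally show ?thesis by simp
    qed
    then show "\<exists>e>0. \<forall>y. y \<in> UNIV \<and> J y \<noteq> J t \<longrightarrow> e \<le> norm (J y - J t)"
      by (intro exI[of _ 1]) auto
  qed
  then have "J (2 * pi) = J 0" unfolding constant_on_def by auto
  moreover have "circ R' (2 * pi) = circ R' 0" by (simp add: circ_def)
  ultimately have "N1 = N2"
    using k1(2) k2(2) by (simp add: J_def)
  then show ?thesis unfolding Z1 Z2 N1_def N2_def .
qed

section \<open>The planar Brouwer degree\<close>

lemma simple_zero_isolated:
  assumes "simple_zero s a g"
  shows "\<forall>\<^sub>F v in at a. g v \<noteq> 0"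
proof -
  obtain c \<theta> where "\<theta> < 1" "\<forall>\<^sub>F v in at a. norm (c * (g v / zero_factor s a v) - 1) \<le> \<theta>"
    using assms unfolding simple_zero_def by blast
  \<comment> \<open>Where \<open>g\<close> vanishes, the norm in question is 1, which exceeds
    \<open>\<theta>\<close>.\<close>
  from this(2) show ?thesis
    by (rule eventually_mono) (use \<open>\<theta> < 1\<close> in auto)
qed

text \<open>Simple zeros are isolated, while an infinite compact set of zeros would contain a limit
  point of itself.\<close>

lemma finite_simple_zeros:
  assumes "compact K" "continuous_on K g" "\<And>a. a \<in> K \<Longrightarrow> g a = 0 \<Longrightarrow> simple_zero (s a) a g"
  shows "finite {v\<in>K. g v = 0}"
proof (rule ccontr)
  let ?Z = "{v\<in>K. g v = 0}"
  assume "infinite ?Z"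
  moreover have "closed ?Z"
    using continuous_closed_preimage_constant[OF assms(2)] assms(1) compact_imp_closed by blast
  then have "compact ?Z"
    using compact_Int_closed[OF assms(1), of ?Z] by (simp add: Int_absorb1 subset_iff)
  ultimately obtain a where a: "a \<in> ?Z" "a islimpt ?Z"
    using Heine_Borel_imp_Bolzano_Weierstrass[of ?Z ?Z] by blast
  moreover have "\<forall>\<^sub>F v in at a. v \<notin> ?Z"
  proof (rule eventually_mono)
    show "\<forall>\<^sub>F v in at a. g v \<noteq> 0" using simple_zero_isolated[OF assms(3)[of a]] a by simp
  qed simp
  ultimately show False by (simp add: islimpt_iff_eventually)
qed

lemma plane_scaleR: "plane (r *\<^sub>R v) = of_real r * plane v"
  by (simp add: plane_def complex_eq_iff)

text \<open>Opposite vectors cannot lie in one open half plane. This supplies the condition on the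
  quotient in \<open>sum_signs_eq\<close>.\<close>

lemma plane_quotient_not_nonpos:
  assumes "v \<bullet> y > 0" "w \<bullet> y > 0"
  shows "plane v / plane w \<notin> \<real>\<^sub>\<le>\<^sub>0"
proof
  assume "plane v / plane w \<in> \<real>\<^sub>\<le>\<^sub>0"
  then obtain r where r: "plane v / plane w = of_real r" "r \<le> 0"
    by (auto elim: nonpos_Reals_cases)
  have "w \<noteq> 0" using assms by auto
  then have "plane v = plane (r *\<^sub>R w)"
    using r(1) by (simp add: plane_scaleR field_simps)
  then have "v = r *\<^sub>R w" by (simp del: plane_simps)
  then show False using assms r(2) by (simp add: zero_less_mult_iff)
qed

text \<open>The half plane given by \<open>y\<close> may turn with \<open>v\<close>; it suffices
  that the two boundary vectors are never opposite, so that their quotient has a logarithm.\<close>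

lemma signed_count_eq:
  fixes g1 g2 :: "real^2 \<Rightarrow> real^2"
  assumes D: "open D" "bounded D" and g: "regular_C1 D 0 g1" "regular_C1 D 0 g2"
    and fr: "\<And>v. v \<in> frontier D \<Longrightarrow> \<exists>y. g1 v \<bullet> y > 0 \<and> g2 v \<bullet> y > 0"
  shows "signed_count g1 D 0 = signed_count g2 D 0"
proof -
  let ?s = "\<lambda>g a. det (matrix (frechet_derivative g (at a))) > 0"
  have compact: "compact (closure D)" using D by (simp add: compact_closure)
  have clD: "closure D = D \<union> frontier D" by (simp add: closure_Un_frontier)
  have props: "continuous_on (closure D) (\<lambda>v. plane (g v))"
      "finite {v\<in>closure D. plane (g v) = 0}" "{v\<in>closure D. plane (g v) = 0} \<subseteq> D"
      "\<And>a. a \<in> D \<Longrightarrow> plane (g a) = 0 \<Longrightarrow> simple_zero (?s g a) a (\<lambda>v. plane (g v))"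
    if g: "regular_C1 D 0 g" and nz: "\<And>v. v \<in> frontier D \<Longrightarrow> g v \<noteq> 0" for g :: "real^2 \<Rightarrow> real^2"
  proof -
    show cont: "continuous_on (closure D) (\<lambda>v. plane (g v))"
      using g unfolding regular_C1_def by (blast intro: continuous_on_plane)
    show sub: "{v\<in>closure D. plane (g v) = 0} \<subseteq> D"
      using nz unfolding clD plane_eq_0_iff by blast
    show simple: "simple_zero (?s g a) a (\<lambda>v. plane (g v))" if "a \<in> D" "plane (g a) = 0" for a
    proof -
      from g obtain g' where "\<forall>x\<in>D. (g has_derivative blinfun_apply (g' x)) (at x)"
        unfolding regular_C1_def by (elim conjE exE) (rule that)
      then obtain A where A: "(g has_derivative A) (at a)"
        using \<open>a \<in> D\<close> by metis
      moreover from A have "frechet_derivative g (at a) = A"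
        using frechet_derivative_at by metis
      moreover have "g a = 0" using that by simp
      moreover from this have "det (matrix (frechet_derivative g (at a))) \<noteq> 0"
        using g that(1) unfolding regular_C1_def by blast
      ultimately show ?thesis
        using simple_zero_if_derivative[OF A] by simp
    qed
    show "finite {v\<in>closure D. plane (g v) = 0}"
      using finite_simple_zeros[OF compact cont, of "?s g"] simple sub by blast
  qed
  have nz: "g1 v \<noteq> 0" "g2 v \<noteq> 0" if "v \<in> frontier D" for v
    using fr[OF that] by (metis inner_zero_left less_irrefl)+
  note p1 = props[OF g(1) nz(1)] and p2 = props[OF g(2) nz(2)]
  have "plane (g1 v) / plane (g2 v) \<notin> \<real>\<^sub>\<le>\<^sub>0" if "v \<in> frontier D" for v
    using fr[OF that] plane_quotient_not_nonpos by blast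
  from sum_signs_eq[OF D p1 p2 this] show ?thesis
    unfolding signed_count_def plane_eq_0_iff .
qed

lemma inner_pos_if_near:
  fixes a b :: "'a::real_inner"
  assumes "norm (a - b) < norm b"
  shows "a \<bullet> b > 0"
proof -
  have "(norm (a - b))\<^sup>2 < (norm b)\<^sup>2"
    using assms by (intro power_strict_mono) auto
  then show ?thesis
    unfolding power2_norm_eq_inner inner_diff_left inner_diff_right inner_commute[of b a]
    using inner_ge_zero[of a] by linarith
qed

lemma signed_count_empty [simp]: "signed_count g {} p = 0"
  by (simp add: signed_count_def)

lemma Brouwer_deg_empty [simp]: "Brouwer_deg f {} p = 0"
  by (simp add: Brouwer_deg_def)

text \<open>This replaces the map chosen by \<open>SOME\<close> by any regular map that lies in the
  half plane of \<open>f\<close> on the frontier: the chosen one lies there as well, since its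
  distance to \<open>f v\<close> is below \<open>norm (f v)\<close>.\<close>

lemma Brouwer_deg_eq_signed_count:
  fixes f g :: "real^2 \<Rightarrow> real^2"
  assumes D: "open D" "bounded D" and f: "continuous_on (closure D) f"
    and g: "regular_C1 D 0 g" "\<And>v. v \<in> frontier D \<Longrightarrow> g v \<bullet> f v > 0"
  shows "Brouwer_deg f D 0 = signed_count g D 0"
proof (cases "D = {}")
  case False
  have nz: "f v \<noteq> 0" if "v \<in> frontier D" for v using g(2)[OF that] by auto
  define d where "d = setdist {0} (f ` frontier D)"
  \<comment> \<open>The distance to an empty set has default value 0, so the positivity of
    \<open>d\<close> rests on a frontier point.\<close>
  have "frontier D \<noteq> {}"
    using False D frontier_eq_empty not_bounded_UNIV by blast
  moreover have "compact (f ` frontier D)"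
    using D f by (intro compact_continuous_image compact_frontier_bounded)
      (auto intro: continuous_on_subset simp: frontier_def)
  ultimately have "d > 0"
    unfolding d_def using nz
    by (subst setdist_gt_0_compact_closed) (auto intro: compact_imp_closed)
  have d: "d \<le> norm (f v)" if "v \<in> frontier D" for v
    unfolding d_def using setdist_le_dist[of 0 "{0}" "f v" "f ` frontier D"] that by simp
  obtain h where "regular_C1 D 0 h" "\<And>x. x \<in> closure D \<Longrightarrow> norm (h x - f x) < d"
    using regular_C1_dense[OF D(2) f \<open>d > 0\<close>] by blast
  then have "regular_approx f D 0 h" by (simp add: regular_approx_iff d_def)
  then have "regular_approx f D 0 (SOME g. regular_approx f D 0 g)"
    by (rule someI[of "regular_approx f D 0"])
  then obtain h where h: "regular_C1 D 0 h" "\<And>x. x \<in> closure D \<Longrightarrow> norm (h x - f x) < d"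
      "h = (SOME g. regular_approx f D 0 g)"
    by (auto simp: regular_approx_iff d_def)
  have "Brouwer_deg f D 0 = signed_count h D 0"
    using D f nz h(3) by (auto simp: Brouwer_deg_def)
  also have "\<dots> = signed_count g D 0"
  proof (rule signed_count_eq[OF D h(1) g(1)])
    fix v assume v: "v \<in> frontier D"
    then have "norm (h v - f v) < norm (f v)"
      using h(2)[of v] d[OF v] by (simp add: frontier_def)
    then show "\<exists>y. h v \<bullet> y > 0 \<and> g v \<bullet> y > 0"
      using inner_pos_if_near g(2)[OF v] by blast
  qed
  finally show ?thesis .
qed simp

lemma compact_norm_lower_bound:
  fixes f :: "'a::topological_space \<Rightarrow> 'b::real_normed_vector"
  assumes "compact C" "continuous_on C f" "\<And>v. v \<in> C \<Longrightarrow> f v \<noteq> 0"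
  obtains m where "m > 0" "\<And>v. v \<in> C \<Longrightarrow> m \<le> norm (f v)"
proof (cases "C = {}")
  case False
  then obtain x where "x \<in> C" "\<And>v. v \<in> C \<Longrightarrow> norm (f x) \<le> norm (f v)"
    using continuous_attains_inf[OF assms(1) False, of "\<lambda>v. norm (f v)"] assms(2)
    by (auto intro: continuous_on_norm)
  then show ?thesis using assms(3) that[of "norm (f x)"] by auto
qed (use that[of 1] in auto)

text \<open>On the closure of \<open>D\<close> outside \<open>N\<close> the map is bounded away from
  0 by some \<open>m\<close>. An approximation closer than \<open>m\<close> has no zeros there, so
  its signed counts in \<open>D\<close> and \<open>N\<close> are the same sum.\<close>

lemma Brouwer_deg_excision:
  fixes f :: "real^2 \<Rightarrow> real^2"
  assumes D: "open D" "bounded D" and f: "continuous_on (closure D) f"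
    and N: "open N" "N \<subseteq> D" and nz: "\<And>v. v \<in> closure D - N \<Longrightarrow> f v \<noteq> 0"
  shows "Brouwer_deg f D 0 = Brouwer_deg f N 0"
proof -
  have "compact (closure D - N)"
    using D N(1) by (intro compact_diff) (auto simp: compact_closure)
  then obtain m where m: "m > 0" "\<And>v. v \<in> closure D - N \<Longrightarrow> m \<le> norm (f v)"
    using compact_norm_lower_bound[of "closure D - N" f] nz f continuous_on_subset by blast
  obtain g where g: "regular_C1 D 0 g" "\<And>x. x \<in> closure D \<Longrightarrow> norm (g x - f x) < m"
    using regular_C1_dense[OF D(2) f m(1)] by blast
  have pos: "g v \<bullet> f v > 0" if "v \<in> closure D - N" for v
    using g(2)[of v] m(2)[OF that] that by (intro inner_pos_if_near) auto
  have frN: "frontier N \<subseteq> closure D - N" and frD: "frontier D \<subseteq> closure D - N"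
    using N D closure_mono[OF N(2)] by (auto simp: frontier_def interior_open)
  have "Brouwer_deg f D 0 = signed_count g D 0"
    using pos frD by (intro Brouwer_deg_eq_signed_count D f g(1)) auto
  also have "\<dots> = signed_count g N 0"
  proof -
    have "{x. x \<in> D \<and> g x = 0} = {x. x \<in> N \<and> g x = 0}"
      using pos closure_subset[of D] N(2) by force
    then show ?thesis unfolding signed_count_def by (rule sum.cong) simp
  qed
  also have "\<dots> = Brouwer_deg f N 0"
    using pos frN closure_mono[OF N(2)] bounded_subset[OF D(2) N(2)]
    by (intro Brouwer_deg_eq_signed_count[symmetric] N(1) regular_C1_subset[OF g(1) N(2)]
        continuous_on_subset[OF f]) auto
  finally show ?thesis .
qed

text \<open>Without zeros in the closure, excision would reduce the domain to the empty set, whose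
  degree is 0.\<close>

lemma Brouwer_deg_nonzero_imp_zero:
  fixes f :: "real^2 \<Rightarrow> real^2"
  assumes "open D" "bounded D" "continuous_on (closure D) f" "Brouwer_deg f D 0 \<noteq> 0"
  shows "\<exists>v\<in>closure D. f v = 0"
  using Brouwer_deg_excision[OF assms(1-3), of "{}"] assms(4) by auto

text \<open>On the frontier a regular map within \<open>m / 4\<close> of \<open>f2\<close> is within
  \<open>m / 2\<close> of \<open>f1\<close>, whose norm exceeds \<open>3 * m / 4\<close>. Thus one
  regular map computes both degrees.\<close>

lemma Brouwer_deg_perturb:
  fixes f1 f2 :: "real^2 \<Rightarrow> real^2"
  assumes D: "open D" "bounded D" and f: "continuous_on (closure D) f1" "continuous_on (closure D) f2"
    and m: "m > 0" "\<And>v. v \<in> frontier D \<Longrightarrow> m \<le> norm (f2 v)"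
    and near: "\<And>v. v \<in> frontier D \<Longrightarrow> norm (f1 v - f2 v) < m / 4"
  shows "Brouwer_deg f1 D 0 = Brouwer_deg f2 D 0"
proof -
  obtain g where g: "regular_C1 D 0 g" "\<And>x. x \<in> closure D \<Longrightarrow> norm (g x - f2 x) < m / 4"
    using regular_C1_dense[OF D(2) f(2), of "m/4" 0] m(1) by auto
  have "g v \<bullet> f1 v > 0 \<and> g v \<bullet> f2 v > 0" if v: "v \<in> frontier D" for v
  proof -
    have 1: "norm (g v - f2 v) < m / 4" using g(2) v by (auto simp: frontier_def)
    have "norm (g v - f1 v) \<le> norm (g v - f2 v) + norm (f1 v - f2 v)"
      using norm_triangle_ineq4[of "g v - f2 v" "f1 v - f2 v"] by simp
    moreover have "norm (f2 v) \<le> norm (f1 v) + norm (f1 v - f2 v)"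
      by (metis norm_minus_commute norm_triangle_sub)
    ultimately have "norm (g v - f1 v) < norm (f1 v)" "norm (g v - f2 v) < norm (f2 v)"
      using 1 near[OF v] m(2)[OF v] m(1) by linarith+
    then show ?thesis using inner_pos_if_near by blast
  qed
  then show ?thesis
    using Brouwer_deg_eq_signed_count[OF D f(1) g(1)] Brouwer_deg_eq_signed_count[OF D f(2) g(1)]
    by simp
qed

text \<open>The projection of a compact set is closed. With \<open>C\<close> a set of bad pairs of
  parameter and point, goodness at \<open>s\<close> persists for nearby parameters.\<close>

lemma notin_fst_image_open:
  fixes C :: "(real \<times> 'a::metric_space) set"
  assumes "compact C" "s \<notin> fst ` C"
  shows "\<forall>\<^sub>F t in at s within I. t \<notin> fst ` C"
proof -
  have "closed (fst ` C)"
    using assms(1) by (intro compact_imp_closed compact_continuous_image continuous_intros)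
  then have "\<forall>\<^sub>F t in at s. t \<in> - fst ` C"
    using assms(2) by (intro eventually_at_in_open') auto
  then show ?thesis
    unfolding eventually_at_filter by (rule eventually_mono) auto
qed

text \<open>The domains are the slices of \<open>W\<close>, so they vary with the parameter. Near one parameter value
  the zeros stay in a fixed open set, to which excision and the perturbation lemma apply.\<close>

lemma Brouwer_deg_homotopy:
  fixes F :: "real \<Rightarrow> real^2 \<Rightarrow> real^2" and W K :: "(real \<times> (real^2)) set"
  assumes I: "I = {a..b}" "s \<in> I" "t \<in> I"
    and F: "continuous_on UNIV (\<lambda>(s, v). F s v)"
    and W: "open W" "W \<subseteq> K" and K: "closed K" "bounded (K \<inter> I \<times> UNIV)"
    and zeros: "\<And>s v. s \<in> I \<Longrightarrow> (s, v) \<in> K \<Longrightarrow> F s v = 0 \<Longrightarrow> (s, v) \<in> W"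
  shows "Brouwer_deg (F s) {v. (s, v) \<in> W} 0 = Brouwer_deg (F t) {v. (t, v) \<in> W} 0"
proof -
  define sl where "sl s = {v. (s, v) \<in> W}" for s
  have contF: "continuous_on A (F s)" for A s
  proof -
    have "continuous_on A (\<lambda>v. case (s, v) of (s, v) \<Rightarrow> F s v)"
      by (rule continuous_on_compose2[OF F]) (auto intro!: continuous_intros)
    then show ?thesis by simp
  qed
  have cK: "compact (K \<inter> I \<times> UNIV)"
    using K I by (auto simp: compact_eq_bounded_closed intro: closed_Int closed_Times)
  have open_sl: "open (sl s)" for s
  proof -
    have "sl s = (\<lambda>v. (s, v)) -` W" by (auto simp: sl_def)
    then show ?thesis using W(1) by (auto intro!: open_vimage continuous_intros)
  qed
  have cl_sl: "closure (sl s) \<subseteq> {v. (s, v) \<in> K}" for s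
  proof (rule closure_minimal)
    have "{v. (s, v) \<in> K} = (\<lambda>v. (s, v)) -` K" by auto
    then show "closed {v. (s, v) \<in> K}" using K(1) by (auto intro!: closed_vimage continuous_intros)
  qed (use W in \<open>auto simp: sl_def\<close>)
  have bdd_sl: "bounded (sl s)" if "s \<in> I" for s
  proof (rule bounded_subset)
    show "bounded (snd ` (K \<inter> I \<times> UNIV))" using K(2) by (rule bounded_snd)
    show "sl s \<subseteq> snd ` (K \<inter> I \<times> UNIV)" using that W(2) by (force simp: sl_def)
  qed
  have "\<forall>\<^sub>F t in at s within I. Brouwer_deg (F s) (sl s) 0 = Brouwer_deg (F t) (sl t) 0"
    if s: "s \<in> I" for s
  proof -
    define A where "A = {v \<in> closure (sl s). F s v = 0}"
    have "compact (closure (sl s))" using bdd_sl[OF s] by (simp add: compact_closure)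
    then have "compact A"
      using continuous_closed_preimage_constant[OF contF, of "closure (sl s)" s 0]
        compact_Int_closed[of "closure (sl s)" A] by (simp add: A_def Int_def)
    moreover have "A \<subseteq> sl s"
      using zeros[OF s] cl_sl by (auto simp: A_def sl_def)
    \<comment> \<open>The zeros of \<open>F s\<close> are separated from the complement of the
      slice, so that even the closure of \<open>N\<close> lies inside the slice.\<close>
    ultimately obtain N V where NV: "open N" "open V" "A \<subseteq> N" "- sl s \<subseteq> V" "N \<inter> V = {}"
      using separation_normal[of A "- sl s"] open_sl[of s] compact_imp_closed[of A]
      by (metis closed_Compl disjoint_eq_subset_Compl double_compl)
    then have N: "open N" "A \<subseteq> N" by auto
    have "closure N \<subseteq> - V"
      using NV by (intro closure_minimal) auto
    then have clN: "closure N \<subseteq> sl s" using NV(4) by blast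
    have bN: "bounded N" using clN closure_subset bdd_sl[OF s] by (meson bounded_subset)
    have "F s v \<noteq> 0" if "v \<in> frontier N" for v
      using that N(1,2) clN closure_subset by (auto simp: frontier_def interior_open A_def)
    then obtain m where m: "m > 0" "\<And>v. v \<in> frontier N \<Longrightarrow> m \<le> norm (F s v)"
      using compact_norm_lower_bound[OF compact_frontier_bounded[OF bN] contF] by blast
    \<comment> \<open>These sets collect the ways in which \<open>N\<close> can fail at a parameter:
      its closure leaves the slice, a zero lies outside of it, or the map is not within
      \<open>m / 4\<close> of \<open>F s\<close> on its frontier. None happens at
      \<open>s\<close>.\<close>
    define C1 where "C1 = (I \<times> closure N) - W"
    define C2 where "C2 = {p \<in> K \<inter> I \<times> UNIV. F (fst p) (snd p) = 0} - UNIV \<times> N"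
    define C3 where "C3 = {p \<in> I \<times> frontier N. m / 4 \<le> norm (F (fst p) (snd p) - F s (snd p))}"
    have contF': "continuous_on X (\<lambda>p. F (fst p) (snd p))" "continuous_on X (\<lambda>p. F s (snd p))" for X
      using F continuous_on_compose2[OF contF[of UNIV s] continuous_on_snd[OF continuous_on_id], of X]
      by (auto simp: case_prod_unfold intro: continuous_on_subset continuous_intros)
    have cI: "compact I" by (simp add: I)
    have "compact C1"
      unfolding C1_def using bN W(1) cI
      by (intro compact_diff compact_Times) (auto simp: compact_closure)
    moreover have "compact C2"
    proof -
      have "closed {p \<in> K \<inter> I \<times> UNIV. F (fst p) (snd p) = 0}"
        by (intro continuous_closed_preimage_constant contF' compact_imp_closed cK)
      then have "compact ((K \<inter> I \<times> UNIV) \<inter> {p \<in> K \<inter> I \<times> UNIV. F (fst p) (snd p) = 0})"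
        by (intro compact_Int_closed cK)
      then show ?thesis
        unfolding C2_def using N(1)
        by (intro compact_diff open_Times) (auto simp: Int_def cong: conj_cong)
    qed
    moreover have "compact C3"
    proof -
      have cc: "compact (I \<times> frontier N)"
        by (intro compact_Times cI compact_frontier_bounded bN)
      have "closed {p \<in> I \<times> frontier N. m / 4 \<le> norm (F (fst p) (snd p) - F s (snd p))}"
        by (intro continuous_on_closed_Collect_le continuous_intros contF' compact_imp_closed cc)
      then show ?thesis
        using compact_Int_closed[OF cc, of C3] by (simp add: C3_def Int_def cong: conj_cong)
    qed
    moreover have "s \<notin> fst ` C1" using clN by (auto simp: C1_def sl_def)
    moreover have "s \<notin> fst ` C2"
    proof
      assume "s \<in> fst ` C2"
      then obtain v where v: "(s, v) \<in> K" "F s v = 0" "v \<notin> N" by (fastforce simp: C2_def)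
      then have "v \<in> A" using zeros[OF s] closure_subset[of "sl s"] by (auto simp: A_def sl_def)
      then show False using v N by blast
    qed
    moreover have "s \<notin> fst ` C3" using m(1) by (auto simp: C3_def)
    ultimately have "\<forall>\<^sub>F t in at s within I. t \<notin> fst ` C1 \<and> t \<notin> fst ` C2 \<and> t \<notin> fst ` C3 \<and> t \<in> I"
      by (intro eventually_conj notin_fst_image_open) (auto simp: eventually_at_filter)
    then show ?thesis
    proof eventually_elim
      case (elim t)
      then have t: "t \<in> I" by simp
      have clNt: "closure N \<subseteq> sl t"
        using elim t by (force simp: C1_def sl_def)
      have nz: "F t v \<noteq> 0" if "v \<in> closure (sl t) - N" for v
        using elim t that cl_sl[of t] by (force simp: C2_def)
      have nzs: "F s v \<noteq> 0" if "v \<in> closure (sl s) - N" for v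
        using that N(2) by (auto simp: A_def)
      have near: "norm (F t v - F s v) < m / 4" if "v \<in> frontier N" for v
        using elim t that by (force simp: C3_def not_le)
      have "Brouwer_deg (F s) (sl s) 0 = Brouwer_deg (F s) N 0"
        using clN closure_subset nzs
        by (intro Brouwer_deg_excision open_sl bdd_sl s contF N(1)) auto
      also have "\<dots> = Brouwer_deg (F t) N 0"
        by (rule Brouwer_deg_perturb[symmetric, OF N(1) bN contF contF m near])
      also have "\<dots> = Brouwer_deg (F t) (sl t) 0"
        using clNt closure_subset nz
        by (intro Brouwer_deg_excision[symmetric] open_sl bdd_sl t contF N(1)) auto
      finally show ?case .
    qed
  qed
  then have "Brouwer_deg (F s) (sl s) 0 = Brouwer_deg (F t) (sl t) 0"
    using I by (intro connected_local_const[of I s t "\<lambda>s. Brouwer_deg (F s) (sl s) 0"]) auto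
  then show ?thesis by (simp add: sl_def)
qed

section \<open>Primitives in the space of continuously differentiable functions\<close>

text \<open>The shot solutions and their limits have this form, with \<open>V\<close> as derivative;
  convergence in the space then follows from convergence of \<open>a\<close> and uniform convergence
  of \<open>V\<close>.\<close>

definition primitive_on :: "real \<Rightarrow> real \<Rightarrow> (real \<Rightarrow> real) \<Rightarrow> real \<Rightarrow> real" where
  "primitive_on T a V = (\<lambda>t\<in>{0..T}. a + integral {0..t} V)"

lemma primitive_on_C1:
  assumes T: "0 < T" and V: "continuous_on {0..T} V"
  shows "primitive_on T a V \<in> C1_space T"
    and "\<And>t. t \<in> {0..T} \<Longrightarrow> deriv_on T (primitive_on T a V) t = V t"
proof -
  have hd: "(primitive_on T a V has_vector_derivative V t) (at t within {0..T})" if t: "t \<in> {0..T}" for t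
  proof -
    have "((\<lambda>t. a + integral {0..t} V) has_vector_derivative V t) (at t within {0..T})"
      using has_vector_derivative_add[OF has_vector_derivative_const[of a]
          integral_has_vector_derivative[OF V t]] by simp
    from has_vector_derivative_transform[OF t _ this] show ?thesis
      by (simp add: primitive_on_def)
  qed
  show d: "deriv_on T (primitive_on T a V) t = V t" if "t \<in> {0..T}" for t
    by (rule deriv_on_eqI[OF T that hd[OF that]])
  have "continuous_on {0..T} (deriv_on T (primitive_on T a V))"
    using V by (rule continuous_on_eq) (simp add: d)
  moreover have "primitive_on T a V differentiable_on {0..T}"
    using hd unfolding differentiable_on_def differentiable_def has_vector_derivative_def by blast
  ultimately show "primitive_on T a V \<in> C1_space T"
    by (simp add: C1_space_def primitive_on_def)
qed

lemma primitive_diff_le: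
  fixes V W :: "real \<Rightarrow> real"
  assumes V: "continuous_on {0..T} V" "continuous_on {0..T} W"
    and a: "\<bar>a - c\<bar> \<le> e" and VW: "\<And>t. t \<in> {0..T} \<Longrightarrow> \<bar>V t - W t\<bar> \<le> e" and t: "t \<in> {0..T}"
  shows "\<bar>a + integral {0..t} V - (c + integral {0..t} W)\<bar> \<le> (1 + T) * e"
proof -
  have cont: "continuous_on {0..t} V" "continuous_on {0..t} W"
    using V t by (auto intro: continuous_on_subset)
  then have "integral {0..t} V - integral {0..t} W = integral {0..t} (\<lambda>s. V s - W s)"
    by (intro integral_diff[symmetric] integrable_continuous_real)
  moreover have "norm (integral {0..t} (\<lambda>s. V s - W s)) \<le> e * (t - 0)"
    using t VW cont by (intro integral_bound continuous_intros) auto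
  moreover have "e * (t - 0) \<le> e * T" using t a by (intro mult_left_mono) auto
  ultimately show ?thesis using a by (auto simp: algebra_simps)
qed

text \<open>One \<open>e\<close> comes from the initial value, \<open>T * e\<close> from the
  integral and one more \<open>e\<close> from the derivative.\<close>

lemma C1_dist_primitive_on:
  assumes T: "0 < T" and V: "continuous_on {0..T} V" "continuous_on {0..T} W"
    and a: "\<bar>a - c\<bar> \<le> e" and VW: "\<And>t. t \<in> {0..T} \<Longrightarrow> \<bar>V t - W t\<bar> \<le> e"
  shows "C1_dist T (primitive_on T a V) (primitive_on T c W) \<le> (2 + T) * e"
proof -
  note C1 = primitive_on_C1[OF T V(1), where a = a] primitive_on_C1[OF T V(2), where a = c]
  have "sup_norm T (\<lambda>t\<in>{0..T}. primitive_on T a V t - primitive_on T c W t) \<le> (1 + T) * e"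
    using primitive_diff_le[OF V a VW] by (intro sup_norm_least T) (simp add: primitive_on_def)
  moreover have "sup_norm T (deriv_on T (\<lambda>t\<in>{0..T}. primitive_on T a V t - primitive_on T c W t)) \<le> e"
    using VW C1(2,4) by (intro sup_norm_least T) (simp add: C1_space_diff(2)[OF T C1(1,3)])
  ultimately show ?thesis
    using C1(1,3) by (simp add: C1_dist_def C1_norm_def algebra_simps)
qed

text \<open>Substitution moves the integral to the fixed interval from 0 to 1. The maximum with 0
  reflects that the original interval is empty for negative \<open>t\<close>.\<close>

lemma continuous_on_integral_upper:
  fixes g :: "'a::topological_space \<Rightarrow> real \<Rightarrow> real"
  assumes "continuous_on UNIV (\<lambda>(p, t). g p t)"
  shows "continuous_on UNIV (\<lambda>(p, t). integral {0..t} (g p))"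
proof -
  have eq: "integral {0..t} (g p) = max 0 t * integral (cbox 0 1) (\<lambda>s. g p (max 0 t * s))" for p t
  proof (cases "t > 0")
    case True
    have "((g p) has_integral integral {0..t} (g p)) (cbox 0 t)"
    proof -
      have "continuous_on {0..t} (\<lambda>s. case (p, s) of (p, t) \<Rightarrow> g p t)"
        by (rule continuous_on_compose2[OF assms]) (auto intro!: continuous_intros)
      then show ?thesis by (simp add: integrable_continuous_real integrable_integral)
    qed
    from has_integral_affinity[OF this, of t 0] True
    have "((\<lambda>s. g p (t * s)) has_integral (1 / t) * integral {0..t} (g p)) ((\<lambda>s. (1 / t) * s) ` {0..t})"
      by simp
    moreover have "(\<lambda>s. (1 / t) * s) ` {0..t} = {0..1}"
      using True by (subst image_mult_atLeastAtMost_if) auto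
    ultimately have "integral {0..1} (\<lambda>s. g p (t * s)) = (1 / t) * integral {0..t} (g p)"
      by (metis integral_unique)
    then show ?thesis using True by simp
  next
    case False
    then show ?thesis by (cases "t = 0") auto
  qed
  have "continuous_on UNIV (\<lambda>x. integral (cbox 0 1) (\<lambda>s. g (fst x) (max 0 (snd x) * s)))"
  proof (rule integral_continuous_on_param)
    have "continuous_on (UNIV \<times> cbox 0 1)
      (\<lambda>y. case (fst (fst y), max 0 (snd (fst y)) * snd y) of (p, t) \<Rightarrow> g p t)"
      by (rule continuous_on_compose2[OF assms]) (auto intro!: continuous_intros)
    then show "continuous_on (UNIV \<times> cbox 0 1) (\<lambda>(x, s). g (fst x) (max 0 (snd x) * s))"
      by (simp add: case_prod_unfold)
  qed
  then have "continuous_on UNIV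
      (\<lambda>x. max 0 (snd x) * integral (cbox 0 1) (\<lambda>s. g (fst x) (max 0 (snd x) * s)))"
    by (intro continuous_intros)
  then show ?thesis by (simp add: case_prod_unfold eq)
qed

text \<open>The evaluation points move with \<open>n\<close> because the delayed time changes with
  the delay.\<close>

lemma tendsto_uniform_limit_seq:
  fixes g :: "'a::topological_space \<Rightarrow> 'b::real_normed_vector"
  assumes f: "uniform_limit S f g sequentially" and g: "continuous_on S g"
    and y: "\<And>n. y n \<in> S" "x \<in> S" "y \<longlonglongrightarrow> x"
  shows "(\<lambda>n. f n (y n)) \<longlonglongrightarrow> g x"
proof (rule Lim_transform)
  show "(\<lambda>n. g (y n)) \<longlonglongrightarrow> g x"
    using continuous_on_tendsto_compose[OF g y(3,2)] y(1) by simp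
  show "(\<lambda>n. f n (y n) - g (y n)) \<longlonglongrightarrow> 0"
  proof (rule tendstoI)
    fix e :: real assume "e > 0"
    with f have "\<forall>\<^sub>F n in sequentially. \<forall>x\<in>S. dist (f n x) (g x) < e" by (rule uniform_limitD)
    then show "\<forall>\<^sub>F n in sequentially. dist (f n (y n) - g (y n)) 0 < e"
      by (rule eventually_mono) (use y in \<open>simp add: dist_norm\<close>)
  qed
qed

text \<open>The difference is an integral over the interval in between. This is the source of
  equicontinuity for the theorem of Arzela and Ascoli.\<close>

lemma integral_Lipschitz:
  fixes g :: "real \<Rightarrow> real"
  assumes g: "continuous_on {0..T} g" "\<And>t. t \<in> {0..T} \<Longrightarrow> \<bar>g t\<bar> \<le> M"
    and st: "s \<in> {0..T}" "t \<in> {0..T}"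
  shows "\<bar>integral {0..s} g - integral {0..t} g\<bar> \<le> M * \<bar>s - t\<bar>"
  using st
proof (induction s t rule: linorder_wlog)
  case (le s t)
  have "g integrable_on {0..t}"
    using g(1) le by (intro integrable_continuous_real) (auto intro: continuous_on_subset)
  then have "integral {0..t} g - integral {0..s} g = integral {s..t} g"
    using Henstock_Kurzweil_Integration.integral_combine[of 0 s t g] le by auto
  moreover have "norm (integral {s..t} g) \<le> M * (t - s)"
    using g le by (intro integral_bound) (auto intro: continuous_on_subset)
  ultimately show ?case using le by (simp add: abs_minus_commute)
qed (simp add: abs_minus_commute)

lemma bounded_on_interval:
  fixes g :: "real \<Rightarrow> real"
  assumes "continuous_on UNIV g"
  obtains M where "M \<ge> 0" "\<And>x. \<bar>x\<bar> \<le> R \<Longrightarrow> \<bar>g x\<bar> \<le> M"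
proof -
  have "compact (g ` {-R..R})"
    using assms by (intro compact_continuous_image) (auto intro: continuous_on_subset)
  then obtain M where "\<And>y. y \<in> g ` {-R..R} \<Longrightarrow> norm y \<le> M" "M > 0"
    using compact_imp_bounded bounded_pos by metis
  then show ?thesis using that[of M] by (force simp: abs_le_iff)
qed

section \<open>Pointwise bounds from the C^1 metric\<close>

lemma C1_dist_upper:
  assumes T: "0 < T" and uv: "u \<in> C1_space T" "v \<in> C1_space T" and t: "t \<in> {0..T}"
  shows "\<bar>u t - v t\<bar> \<le> C1_dist T u v" "\<bar>deriv_on T u t - deriv_on T v t\<bar> \<le> C1_dist T u v"
proof -
  let ?w = "\<lambda>t\<in>{0..T}. u t - v t"
  note cont = C1_space_continuous[OF C1_space_diff(1)[OF T uv]]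
  have "\<bar>u t - v t\<bar> \<le> sup_norm T ?w"
    using sup_norm_upper[OF cont(1) t] t by simp
  moreover have "\<bar>deriv_on T u t - deriv_on T v t\<bar> \<le> sup_norm T (deriv_on T ?w)"
    using sup_norm_upper[OF cont(2) t] C1_space_diff(2)[OF T uv t] by simp
  ultimately show "\<bar>u t - v t\<bar> \<le> C1_dist T u v" "\<bar>deriv_on T u t - deriv_on T v t\<bar> \<le> C1_dist T u v"
    using uv by (auto simp: C1_dist_def C1_norm_def)
qed

lemma C1_bounded_imp:
  assumes T: "0 < T" and S: "C1_bounded T S"
  obtains R where "\<And>u t. u \<in> S \<Longrightarrow> t \<in> {0..T} \<Longrightarrow> \<bar>u t\<bar> \<le> R \<and> \<bar>deriv_on T u t\<bar> \<le> R"
proof (cases "S = {}")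
  case False
  interpret Metric_space "C1_space T" "C1_dist T" by (rule C1_Metric_space[OF T])
  obtain x B where xB: "x \<in> C1_space T" "\<And>u. u \<in> S \<Longrightarrow> u \<in> C1_space T \<and> C1_dist T x u \<le> B"
    using S False unfolding mbounded by blast
  have "\<bar>u t\<bar> \<le> sup_norm T x + sup_norm T (deriv_on T x) + B \<and>
        \<bar>deriv_on T u t\<bar> \<le> sup_norm T x + sup_norm T (deriv_on T x) + B"
    if u: "u \<in> S" and t: "t \<in> {0..T}" for u t
    using C1_dist_upper[OF T xB(1) _ t, of u] xB(2)[OF u]
      sup_norm_upper[OF C1_space_continuous(1)[OF xB(1)] t]
      sup_norm_upper[OF C1_space_continuous(2)[OF xB(1)] t]
    by linarith
  then show ?thesis using that by blast
qed (use that in auto)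

section \<open>The delayed initial value problem\<close>

locale delay_family =
  fixes T b :: real and \<phi> :: "real \<Rightarrow> real" and f :: "real \<Rightarrow> real \<Rightarrow> real \<Rightarrow> real"
  assumes T: "0 < T"
    and hom: "homeomorphism UNIV UNIV \<phi> (inv \<phi>)"
    and cont_f: "continuous_on ({0..T} \<times> UNIV \<times> UNIV) (\<lambda>(t, x, y). f t x y)"
begin

text \<open>The time is clamped to the interval, which makes the right-hand side continuous on the
  whole space.\<close>

definition fe :: "real \<Rightarrow> real \<Rightarrow> real \<Rightarrow> real" where
  "fe t = f (max 0 (min T t))"

lemma continuous_on_fe [continuous_intros]:
  assumes "continuous_on S t" "continuous_on S x" "continuous_on S y"
  shows "continuous_on S (\<lambda>z. fe (t z) (x z) (y z))"
proof -
  have "continuous_on S (\<lambda>z. case (max 0 (min T (t z)), x z, y z) of (t, x, y) \<Rightarrow> f t x y)"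
    by (rule continuous_on_compose2[OF cont_f])
       (use T in \<open>auto intro!: continuous_intros assms\<close>)
  then show ?thesis by (simp add: fe_def)
qed

lemma inv_phi [simp]: "inv \<phi> (\<phi> x) = x" "\<phi> (inv \<phi> x) = x"
  using hom by (auto simp: homeomorphism_def)

lemma continuous_on_phi [continuous_intros]:
  "continuous_on S g \<Longrightarrow> continuous_on S (\<lambda>x. \<phi> (g x))"
  "continuous_on S g \<Longrightarrow> continuous_on S (\<lambda>x. inv \<phi> (g x))"
  using hom by (auto simp: homeomorphism_def intro: continuous_on_compose2)

lemma continuous_on_B_fun [continuous_intros]:
  "continuous_on S g \<Longrightarrow> continuous_on S (\<lambda>x. B_fun \<phi> b (g x))"
  unfolding B_fun_def by (intro continuous_intros)

text \<open>Here \<open>p = (s, (a, x))\<close>, where \<open>a\<close> and \<open>x\<close> are the prescribed initial values of \<open>u\<close> and \<open>u'\<close>,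
  and \<open>mom h p u'\<close> is the momentum that the equation with delay \<open>h\<close> assigns to \<open>u'\<close>. The weights
  are \<open>(0, s)\<close> for \<open>s\<close> in \<open>[0, 1]\<close> (the equation \<open>u = Z(s, u)\<close>) and \<open>(s - 1, 2 - s)\<close> for \<open>s\<close> in
  \<open>[1, 2]\<close> (the boundary value problem with \<open>\<lambda> = s - 1\<close>).\<close>

definition mom :: "real \<Rightarrow> real \<times> (real^2) \<Rightarrow> (real \<Rightarrow> real) \<Rightarrow> real \<Rightarrow> real" where
  "mom h p V t = \<phi> (snd p $ 2)
     + max 0 (fst p - 1) * integral {0..t} (\<lambda>q. fe q
         (snd p $ 1 + integral {0..max 0 (q - h)} V) (V (max 0 (q - h))))
     + (1 - \<bar>1 - fst p\<bar>) * t * B_fun \<phi> b (snd p $ 1) / T"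

text \<open>Picard iteration from the constant velocity. Because of the delay each round settles the
  solution on a further interval of length \<open>h\<close>, so finitely many rounds
  suffice.\<close>

primrec vel_iter :: "real \<Rightarrow> nat \<Rightarrow> real \<times> (real^2) \<Rightarrow> real \<Rightarrow> real" where
  "vel_iter h 0 p = (\<lambda>t. snd p $ 2)"
| "vel_iter h (Suc n) p = (\<lambda>t. inv \<phi> (mom h p (vel_iter h n p) t))"

lemma continuous_on_vel_iter: "continuous_on UNIV (\<lambda>(p, t). vel_iter h n p t)"
proof (induction n)
  case 0
  show ?case by (simp add: case_prod_unfold) (intro continuous_intros)
next
  case (Suc n)
  have V: "continuous_on UNIV (\<lambda>z. vel_iter h n (fst z) (max 0 (snd z - h)))"
    using continuous_on_compose2[OF Suc, of UNIV "\<lambda>z. (fst z, max 0 (snd z - h))"]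
    by (simp add: continuous_intros)
  have I: "continuous_on UNIV (\<lambda>z. integral {0..max 0 (snd z - h)} (vel_iter h n (fst z)))"
    using continuous_on_compose2[OF continuous_on_integral_upper[OF Suc], of UNIV
        "\<lambda>z. (fst z, max 0 (snd z - h))"]
    by (simp add: continuous_intros)
  have "continuous_on UNIV (\<lambda>(p, q). fe q
         (snd p $ 1 + integral {0..max 0 (q - h)} (vel_iter h n p)) (vel_iter h n p (max 0 (q - h))))"
    unfolding case_prod_unfold by (intro continuous_intros V I)
  from continuous_on_integral_upper[OF this]
  show ?case
    unfolding vel_iter.simps mom_def case_prod_unfold
    by (intro continuous_intros) (use T in auto)
qed

text \<open>The momentum at time \<open>t\<close> sees the velocity only up to
  \<open>max 0 (t - h)\<close>, where the induction hypothesis applies.\<close>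

lemma vel_iter_stable:
  assumes "0 < h" "t \<in> {0..real n * h}"
  shows "vel_iter h (Suc n) p t = vel_iter h n p t"
  using assms(2)
proof (induction n arbitrary: t)
  \<comment> \<open>Only \<open>t = 0\<close> is left, where the momentum is the prescribed initial
    one.\<close>
  case 0
  then show ?case by (simp add: mom_def)
next
  case (Suc n)
  let ?V = "vel_iter h n p" and ?W = "vel_iter h (Suc n) p"
  have q: "max 0 (q - h) \<in> {0..real n * h}" if "q \<in> {0..t}" for q
    using that Suc.prems assms(1) by (auto simp: algebra_simps)
  have "integral {0..t} (\<lambda>q. fe q (snd p $ 1 + integral {0..max 0 (q - h)} ?W) (?W (max 0 (q - h))))
      = integral {0..t} (\<lambda>q. fe q (snd p $ 1 + integral {0..max 0 (q - h)} ?V) (?V (max 0 (q - h))))"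
  proof (rule integral_cong)
    fix q assume qt: "q \<in> {0..t}"
    have "integral {0..max 0 (q - h)} ?W = integral {0..max 0 (q - h)} ?V"
      using q[OF qt] by (intro integral_cong Suc.IH) auto
    then show "fe q (snd p $ 1 + integral {0..max 0 (q - h)} ?W) (?W (max 0 (q - h)))
       = fe q (snd p $ 1 + integral {0..max 0 (q - h)} ?V) (?V (max 0 (q - h)))"
      using Suc.IH[OF q[OF qt]] by simp
  qed
  then have "mom h p ?W t = mom h p ?V t"
    unfolding mom_def by (simp del: vel_iter.simps)
  then show ?case
    unfolding vel_iter.simps(2)[of h "Suc n"] vel_iter.simps(2)[of h n "p"] by simp
qed

text \<open>With delay \<open>T / Suc n\<close>, exactly \<open>Suc n\<close> rounds reach the time
  \<open>T\<close>; by \<open>vel_iter_stable\<close> the iterate solves the delayed equation on the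
  whole interval.\<close>

definition vel :: "nat \<Rightarrow> real \<times> (real^2) \<Rightarrow> real \<Rightarrow> real" where
  "vel n = vel_iter (T / Suc n) (Suc n)"

definition sol :: "nat \<Rightarrow> real \<times> (real^2) \<Rightarrow> real \<Rightarrow> real" where
  "sol n p = primitive_on T (snd p $ 1) (vel n p)"

text \<open>The integral is taken without delay, so that \<open>bc n 0\<close> is exactly the map \<open>G\<close>.\<close>

definition bc :: "nat \<Rightarrow> real \<Rightarrow> real^2 \<Rightarrow> real^2" where
  "bc n s v = vector
     [B_fun \<phi> b (v$1) / T - 1 / T * integral {0..T} (\<lambda>t. fe t (v$1 + integral {0..t} (vel n (s, v))) (vel n (s, v) t)),
      - (v$1) + v$2]"

lemma continuous_on_vel: "continuous_on UNIV (\<lambda>(p, t). vel n p t)"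
  unfolding vel_def by (rule continuous_on_vel_iter)

lemma continuous_on_vel_snd: "continuous_on S (vel n p)"
  using continuous_on_compose2[OF continuous_on_vel, of S "\<lambda>t. (p, t)"]
  by (simp add: continuous_intros)

lemma phi_vel:
  assumes "t \<in> {0..T}"
  shows "\<phi> (vel n p t) = mom (T / Suc n) p (vel n p) t"
proof -
  have "vel_iter (T / Suc n) (Suc (Suc n)) p t = vel n p t"
    unfolding vel_def using assms T by (intro vel_iter_stable) (auto simp del: of_nat_Suc)
  then show ?thesis
    unfolding vel_def vel_iter.simps(2)[of _ "Suc n"] by (metis inv_phi(2))
qed

text \<open>Both weights in \<open>mom\<close> vanish at parameter 0. The solutions are then affine,
  which brings in the slice of \<Omega> and the map \<open>G_map\<close>.\<close>

lemma vel_0: "vel n (0, v) = (\<lambda>t. v$2)"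
  unfolding vel_def by (simp add: mom_def fun_eq_iff)

lemma bc_0: "bc n 0 = G_map T b \<phi> f"
proof
  fix v
  have "integral {0..T} (\<lambda>t. fe t (v$1 + integral {0..t} (vel n (0, v))) (vel n (0, v) t))
      = integral {0..T} (\<lambda>t. f t (v$1 + v$2 * t) (v$2))"
    by (intro integral_cong) (simp add: vel_0 fe_def mult.commute)
  then show "bc n 0 v = G_map T b \<phi> f v" by (simp add: bc_def G_map_def)
qed

lemma sol_0: "sol n (0, v) = (\<lambda>t\<in>{0..T}. v$1 + v$2 * t)"
  by (auto simp: sol_def primitive_on_def vel_0 fun_eq_iff restrict_def)

lemma continuous_on_bc: "continuous_on UNIV (\<lambda>(s, v). bc n s v)"
proof -
  have I: "continuous_on UNIV (\<lambda>z. integral {0..snd z} (vel n (fst z)))"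
    using continuous_on_integral_upper[OF continuous_on_vel] by (simp add: case_prod_unfold)
  have V: "continuous_on UNIV (\<lambda>z. vel n (fst z) (snd z))"
    using continuous_on_vel by (simp add: case_prod_unfold)
  have "continuous_on UNIV (\<lambda>z. fe (snd z) (snd (fst z) $ 1 + integral {0..snd z} (vel n (fst z)))
     (vel n (fst z) (snd z)))"
    by (intro continuous_intros V I)
  then have "continuous_on (UNIV \<times> cbox 0 T) (\<lambda>(p, t). fe t (snd p $ 1 + integral {0..t} (vel n p)) (vel n p t))"
    by (auto simp: case_prod_unfold intro: continuous_on_subset)
  from integral_continuous_on_param[OF this]
  have *: "continuous_on UNIV (\<lambda>p. integral {0..T} (\<lambda>t. fe t (snd p $ 1 + integral {0..t} (vel n p)) (vel n p t)))"
    by simp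
  have "(\<lambda>(s, v). bc n s v) = (\<lambda>p. \<chi> i. if i = 1 then
     B_fun \<phi> b (snd p $ 1) / T - 1 / T * integral {0..T} (\<lambda>t. fe t (snd p $ 1 + integral {0..t} (vel n p)) (vel n p t))
     else - (snd p $ 1) + snd p $ 2)"
    by (auto simp: bc_def fun_eq_iff vec_eq_iff forall_2)
  moreover have "continuous_on UNIV (\<lambda>p. \<chi> i. if i = 1 then
     B_fun \<phi> b (snd p $ 1) / T - 1 / T * integral {0..T} (\<lambda>t. fe t (snd p $ 1 + integral {0..t} (vel n p)) (vel n p t))
     else - (snd p $ 1) + snd p $ (2::2))"
    by (intro continuous_on_vec_lambda, rename_tac i, case_tac "i = 1")
       (use T in \<open>auto intro!: continuous_intros *\<close>)
  ultimately show ?thesis by simp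
qed

section \<open>Continuity of the solution family in C^1\<close>

lemma sol_C1: "sol n p \<in> C1_space T"
  unfolding sol_def by (rule primitive_on_C1(1)[OF T continuous_on_vel_snd])

lemma deriv_sol: "t \<in> {0..T} \<Longrightarrow> deriv_on T (sol n p) t = vel n p t"
  unfolding sol_def by (rule primitive_on_C1(2)[OF T continuous_on_vel_snd])

interpretation C1: Metric_space "C1_space T" "C1_dist T"
  by (rule C1_Metric_space[OF T])

text \<open>By compactness of the time interval, nearby parameters have uniformly close velocities,
  so \<open>C1_dist_primitive_on\<close> makes \<open>sol n\<close> continuous into the
  space.\<close>

lemma open_sol_vimage:
  assumes "openin (C1_topology T) \<Omega>"
  shows "open {p. sol n p \<in> \<Omega>}"
proof (subst open_subopen, intro ballI)
  fix p assume "p \<in> {p. sol n p \<in> \<Omega>}"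
  then obtain r where r: "r > 0" "C1.mball (sol n p) r \<subseteq> \<Omega>"
    using assms by (auto simp: C1.openin_mtopology)
  define e where "e = r / (2 * (2 + T))"
  have e: "e > 0" "(2 + T) * e < r" using r T by (auto simp: e_def divide_less_eq algebra_simps add_pos_pos)
  have "continuous_on (UNIV \<times> {0..T}) (\<lambda>(p, t). vel n p t)"
    using continuous_on_vel by (rule continuous_on_subset) auto
  then obtain X where X: "p \<in> X" "open X" "\<forall>x\<in>X \<inter> UNIV. \<forall>t\<in>{0..T}. dist (vel n x t) (vel n p t) \<le> e"
    using continuous_on_prod_compactE[of UNIV "{0..T}" "\<lambda>(p, t). vel n p t" p e] e(1) by auto
  show "\<exists>X. open X \<and> p \<in> X \<and> X \<subseteq> {p. sol n p \<in> \<Omega>}"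
  proof (intro exI conjI subsetI)
    show "open (X \<inter> ball p e)" "p \<in> X \<inter> ball p e" using X e by auto
    fix x assume x: "x \<in> X \<inter> ball p e"
    have "\<bar>snd p $ 1 - snd x $ 1\<bar> \<le> norm (snd p - snd x)"
      using component_le_norm_cart[of "snd p - snd x" 1] by simp
    also have "\<dots> \<le> e" using x dist_snd_le[of p x] by (simp add: dist_norm)
    finally have "C1_dist T (sol n p) (sol n x) \<le> (2 + T) * e"
      unfolding sol_def using X(3) x
      by (intro C1_dist_primitive_on T continuous_on_vel_snd) (auto simp: dist_real_def abs_minus_commute)
    then have "sol n x \<in> C1.mball (sol n p) r"
      using e(2) sol_C1 by auto
    then show "x \<in> {p. sol n p \<in> \<Omega>}" using r(2) by blast
  qed
qed

lemma closed_sol_vimage: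
  assumes "closedin (C1_topology T) \<Omega>"
  shows "closed {p. sol n p \<in> \<Omega>}"
proof -
  have "openin (C1_topology T) (C1_space T - \<Omega>)"
    using assms by (simp add: closedin_def)
  from open_sol_vimage[OF this, of n] have "open {p. sol n p \<in> C1_space T - \<Omega>}" .
  moreover have "{p. sol n p \<in> C1_space T - \<Omega>} = - {p. sol n p \<in> \<Omega>}"
    using sol_C1 by auto
  ultimately show ?thesis by (simp add: closed_def)
qed

section \<open>The limit of vanishing delay\<close>

lemma continuous_on_delayed:
  "continuous_on S (\<lambda>q. fe q (c + integral {0..max 0 (q - h)} (vel n p)) (vel n p (max 0 (q - h))))"
proof -
  have "continuous_on S (\<lambda>q. integral {0..max 0 (q - h)} (vel n p))"
    using continuous_on_compose2[OF continuous_on_integral_upper[OF continuous_on_vel], of S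
        "\<lambda>q. (p, max 0 (q - h))"]
    by (simp add: continuous_intros)
  moreover have "continuous_on S (\<lambda>q. vel n p (max 0 (q - h)))"
    by (rule continuous_on_compose2[OF continuous_on_vel_snd[of UNIV]]) (auto intro!: continuous_intros)
  ultimately show ?thesis by (intro continuous_intros)
qed

lemma vel_at_0: "vel n p 0 = snd p $ 2"
proof -
  have "\<phi> (vel n p 0) = \<phi> (snd p $ 2)"
    using phi_vel[of 0 n p] T by (simp add: mom_def)
  from arg_cong[OF this, of "inv \<phi>"] show ?thesis by simp
qed

lemma tendsto_phi [tendsto_intros]:
  assumes "(g \<longlongrightarrow> l) F"
  shows "((\<lambda>x. \<phi> (g x)) \<longlongrightarrow> \<phi> l) F" "((\<lambda>x. B_fun \<phi> b (g x)) \<longlongrightarrow> B_fun \<phi> b l) F"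
proof -
  have "continuous_on UNIV \<phi>" "continuous_on UNIV (B_fun \<phi> b)"
    using continuous_on_phi(1)[of UNIV "\<lambda>x. x"] continuous_on_B_fun[of UNIV "\<lambda>x. x"]
    by (simp_all add: continuous_on_id)
  then show "((\<lambda>x. \<phi> (g x)) \<longlongrightarrow> \<phi> l) F" "((\<lambda>x. B_fun \<phi> b (g x)) \<longlongrightarrow> B_fun \<phi> b l) F"
    using assms continuous_on_tendsto_compose[of UNIV _ g l F] by auto
qed

lemma tendsto_fe [tendsto_intros]:
  assumes "(g \<longlongrightarrow> x) F" "(h \<longlongrightarrow> y) F"
  shows "((\<lambda>z. fe q (g z) (h z)) \<longlongrightarrow> fe q x y) F"
proof -
  have "continuous_on UNIV (\<lambda>z. fe q (fst z) (snd z))"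
    by (intro continuous_intros)
  from continuous_on_tendsto_compose[OF this tendsto_Pair[OF assms]] show ?thesis by simp
qed

lemma fe_bounded:
  obtains M where "M \<ge> 0" "\<And>t x y. \<bar>x\<bar> \<le> R \<Longrightarrow> \<bar>y\<bar> \<le> R \<Longrightarrow> \<bar>fe t x y\<bar> \<le> M"
proof -
  have "compact ((\<lambda>(t, x, y). f t x y) ` ({0..T} \<times> {-R..R} \<times> {-R..R}))"
    by (intro compact_continuous_image compact_Times continuous_on_subset[OF cont_f]) auto
  then obtain M where M: "M > 0"
      "\<And>z. z \<in> (\<lambda>(t, x, y). f t x y) ` ({0..T} \<times> {-R..R} \<times> {-R..R}) \<Longrightarrow> norm z \<le> M"
    using compact_imp_bounded bounded_pos by metis
  have "\<bar>fe t x y\<bar> \<le> M" if "\<bar>x\<bar> \<le> R" "\<bar>y\<bar> \<le> R" for t x y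
  proof -
    have "(max 0 (min T t), x, y) \<in> {0..T} \<times> {-R..R} \<times> {-R..R}"
      using that T by auto
    from M(2)[OF imageI[OF this]] show ?thesis by (simp add: fe_def)
  qed
  then show ?thesis using that M(1) by (meson less_imp_le)
qed

text \<open>The equation bounds the slope of the momenta, not of the velocities, so the theorem of
  Arzela and Ascoli is applied to the momenta \<open>W\<close>. The inverse of \<open>\<phi>\<close>
  carries uniform convergence back to the velocities.\<close>

lemma delay_limit:
  assumes s: "\<And>n. fst (p n) \<in> {0..2}"
    and bound: "\<And>n t. t \<in> {0..T} \<Longrightarrow> \<bar>sol n (p n) t\<bar> \<le> R"
      "\<And>n t. t \<in> {0..T} \<Longrightarrow> \<bar>vel n (p n) t\<bar> \<le> R"
    and zero: "\<And>n. bc n (fst (p n)) (snd (p n)) = 0"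
  obtains r s a V where "strict_mono r" "s \<in> {0..2}" "(\<lambda>n. fst (p (r n))) \<longlonglongrightarrow> s"
    "continuous_on {0..T} V"
    "limitin (C1_topology T) (\<lambda>n. sol (r n) (p (r n))) (primitive_on T a V) sequentially"
    "\<forall>t\<in>{0..T}. \<phi> (V t) = \<phi> a
       + max 0 (s - 1) * integral {0..t} (\<lambda>q. f q (a + integral {0..q} V) (V q))
       + (1 - \<bar>1 - s\<bar>) * t * B_fun \<phi> b a / T"
    "B_fun \<phi> b a / T = 1 / T * integral {0..T} (\<lambda>q. f q (a + integral {0..q} V) (V q))"
proof -
  define a where "a n = snd (p n) $ 1" for n
  define V where "V n = vel n (p n)" for n
  define U where "U n t = a n + integral {0..t} (V n)" for n t
  define W where "W n t = \<phi> (V n t)" for n t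
  \<comment> \<open>The second component of \<open>bc\<close> equates the initial velocity with the
    initial position, so \<open>a n\<close> stands for both.\<close>
  have x: "snd (p n) $ 2 = a n" for n
    using zero[of n] by (simp add: bc_def a_def vec_eq_iff forall_2)
  have V0: "V n 0 = a n" for n using vel_at_0[of n "p n"] x by (simp add: V_def)
  have U: "sol n (p n) t = U n t" if "t \<in> {0..T}" for n t
    using that by (simp add: sol_def primitive_on_def U_def a_def V_def)
  have bU: "\<bar>U n t\<bar> \<le> R" and bV: "\<bar>V n t\<bar> \<le> R" if "t \<in> {0..T}" for n t
    using bound[OF that, of n] U[OF that, of n] by (auto simp: V_def)
  have ba: "\<bar>a n\<bar> \<le> R" for n using bV[of 0 n] T V0[of n] by simp
  obtain M where M: "M \<ge> 0" "\<And>t x y. \<bar>x\<bar> \<le> R \<Longrightarrow> \<bar>y\<bar> \<le> R \<Longrightarrow> \<bar>fe t x y\<bar> \<le> M"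
    using fe_bounded by blast
  obtain M1 where M1: "\<And>x. \<bar>x\<bar> \<le> R \<Longrightarrow> \<bar>\<phi> x\<bar> \<le> M1"
    using bounded_on_interval[of \<phi> R] continuous_on_phi(1)[of UNIV "\<lambda>x. x"]
    by (auto simp: continuous_on_id)
  obtain M2 where M2: "M2 \<ge> 0" "\<And>x. \<bar>x\<bar> \<le> R \<Longrightarrow> \<bar>B_fun \<phi> b x\<bar> \<le> M2"
    using bounded_on_interval[of "B_fun \<phi> b" R] continuous_on_B_fun[of UNIV "\<lambda>x. x"]
    by (auto simp: continuous_on_id)
  define g where "g n h q = fe q (U n (max 0 (q - h))) (V n (max 0 (q - h)))" for n h q
  have contg: "continuous_on S (g n h)" for S n h
    unfolding g_def U_def V_def by (rule continuous_on_delayed)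
  have bg: "\<bar>g n h q\<bar> \<le> M" if "q \<in> {0..T}" "0 \<le> h" for n h q
    unfolding g_def using that T by (intro M(2) bU bV) auto
  have Weq: "W n t = \<phi> (a n) + max 0 (fst (p n) - 1) * integral {0..t} (g n (T / Suc n))
      + (1 - \<bar>1 - fst (p n)\<bar>) * t * B_fun \<phi> b (a n) / T" if "t \<in> {0..T}" for n t
    using phi_vel[OF that, of n "p n"]
    by (simp add: W_def V_def mom_def g_def[abs_def] U_def a_def x[unfolded a_def])
  \<comment> \<open>\<open>M\<close> bounds the slope of the integral term, \<open>M2 / T\<close>
    that of the linear term, and 1 keeps \<open>L\<close> positive for the division by it.\<close>
  define L where "L = M + M2 / T + 1"
  have L: "L > 0" using M(1) M2(1) T by (simp add: L_def add_nonneg_pos)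
  have lip: "\<bar>W n t - W n t'\<bar> \<le> L * \<bar>t - t'\<bar>" if t: "t \<in> {0..T}" "t' \<in> {0..T}" for n t t'
  proof -
    let ?\<sigma> = "max 0 (fst (p n) - 1)" and ?\<tau> = "1 - \<bar>1 - fst (p n)\<bar>"
    let ?I = "\<lambda>t. integral {0..t} (g n (T / Suc n))"
    have st: "\<bar>?\<sigma>\<bar> \<le> 1" "\<bar>?\<tau>\<bar> \<le> 1" using s[of n] by auto
    have "\<bar>?I t - ?I t'\<bar> \<le> M * \<bar>t - t'\<bar>"
      using T by (intro integral_Lipschitz[OF contg bg t]) auto
    then have 1: "\<bar>?\<sigma> * (?I t - ?I t')\<bar> \<le> 1 * (M * \<bar>t - t'\<bar>)"
      unfolding abs_mult using st by (intro mult_mono) auto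
    have 2: "\<bar>?\<tau> * (t - t') * (B_fun \<phi> b (a n) / T)\<bar> \<le> 1 * \<bar>t - t'\<bar> * (M2 / T)"
      unfolding abs_mult using st T M2(2)[OF ba] M2(1)
      by (intro mult_mono) (auto simp: abs_mult divide_right_mono)
    have eq: "W n t - W n t' = ?\<sigma> * (?I t - ?I t') + ?\<tau> * (t - t') * (B_fun \<phi> b (a n) / T)"
      unfolding Weq[OF t(1)] Weq[OF t(2)] using T by (simp add: field_simps)
    have "\<bar>W n t - W n t'\<bar> \<le> 1 * (M * \<bar>t - t'\<bar>) + 1 * \<bar>t - t'\<bar> * (M2 / T)"
      unfolding eq by (rule order_trans[OF abs_triangle_ineq add_mono[OF 1 2]])
    also have "\<dots> \<le> L * \<bar>t - t'\<bar>" by (simp add: L_def algebra_simps)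
    finally show ?thesis .
  qed
  \<comment> \<open>The parameters are made to converge first; the further subsequence for the
    momenta keeps this.\<close>
  define z where "z n = (fst (p n), a n)" for n
  have "z n \<in> {0..2} \<times> {-R..R}" for n
    using s[of n] ba[of n] by (auto simp: z_def abs_le_iff)
  moreover have "seq_compact ({0..2} \<times> {-R..R} :: (real \<times> real) set)"
    by (intro compact_imp_seq_compact compact_Times) auto
  ultimately obtain l r1 where r1: "l \<in> {0..2} \<times> {-R..R}" "strict_mono r1" "(z \<circ> r1) \<longlonglongrightarrow> l"
    using seq_compactE by metis
  obtain w k where k: "continuous_on {0..T} w" "strict_mono (k :: nat \<Rightarrow> nat)"
      "\<And>e. 0 < e \<Longrightarrow> \<exists>N. \<forall>n x. n \<ge> N \<and> x \<in> {0..T} \<longrightarrow> norm (W (r1 (k n)) x - w x) < e"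
  proof (rule Arzela_Ascoli[of "{0..T}" "\<lambda>n. W (r1 n)" M1])
    show "norm (W (r1 n) x) \<le> M1" if "x \<in> {0..T}" for n x
      using M1 bV[OF that] by (simp add: W_def)
    show "\<exists>d>0. \<forall>n y. y \<in> {0..T} \<and> norm (x - y) < d \<longrightarrow> norm (W (r1 n) x - W (r1 n) y) < e"
      if "x \<in> {0..T}" "0 < e" for x e
    proof (intro exI[of _ "e / L"] conjI allI impI)
      fix n y assume y: "y \<in> {0..T} \<and> norm (x - y) < e / L"
      have "\<bar>W (r1 n) x - W (r1 n) y\<bar> \<le> L * \<bar>x - y\<bar>" using lip that y by blast
      also have "\<dots> < L * (e / L)" using y L by (intro mult_strict_left_mono) auto
      finally show "norm (W (r1 n) x - W (r1 n) y) < e" using L by simp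
    qed (use that L in simp)
  qed auto
  define r where "r = r1 \<circ> k"
  have r: "strict_mono r" unfolding r_def using r1 k strict_mono_o by blast
  have "((z \<circ> r1) \<circ> k) \<longlonglongrightarrow> l" using r1(3) k(2) by (rule LIMSEQ_subseq_LIMSEQ)
  then have zl: "(\<lambda>n. z (r n)) \<longlonglongrightarrow> l" by (simp add: r_def o_def)
  define s where "s = fst l"
  define a' where "a' = snd l"
  have sl: "(\<lambda>n. fst (p (r n))) \<longlonglongrightarrow> s" and al: "(\<lambda>n. a (r n)) \<longlonglongrightarrow> a'"
    using tendsto_fst[OF zl] tendsto_snd[OF zl] by (simp_all add: z_def s_def a'_def)
  have s02: "s \<in> {0..2}" using r1(1) by (auto simp: s_def)
  define V' where "V' t = inv \<phi> (w t)" for t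
  define U' where "U' t = a' + integral {0..t} V'" for t
  have contV: "continuous_on {0..T} V'"
    unfolding V'_def by (intro continuous_intros k(1))
  have ulW: "uniform_limit {0..T} (\<lambda>n. W (r n)) w sequentially"
  proof (rule uniform_limitI)
    fix e :: real assume "e > 0"
    then obtain N where "\<And>n x. n \<ge> N \<Longrightarrow> x \<in> {0..T} \<Longrightarrow> norm (W (r1 (k n)) x - w x) < e"
      using k(3) by metis
    then show "\<forall>\<^sub>F n in sequentially. \<forall>x\<in>{0..T}. dist (W (r n) x) (w x) < e"
      unfolding eventually_sequentially dist_norm r_def o_def by (intro exI[of _ N]) blast
  qed
  have bW: "W n t \<in> {-M1..M1}" if "t \<in> {0..T}" for n t
    using M1[OF bV[OF that, of n]] by (auto simp: W_def abs_le_iff)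
  \<comment> \<open>The momenta stay in a compact interval, on which \<open>inv \<phi>\<close> is
    uniformly continuous.\<close>
  have ulV: "uniform_limit {0..T} (\<lambda>n. V (r n)) V' sequentially"
  proof -
    have "continuous_on {-M1..M1} (inv \<phi>)"
      using continuous_on_phi(2)[of _ "\<lambda>x. x"] by (simp add: continuous_on_id)
    then have "uniform_limit {0..T} (\<lambda>n t. inv \<phi> (W (r n) t)) (\<lambda>t. inv \<phi> (w t)) sequentially"
      using bW by (intro uniform_limit_compose_uniformly_continuous_on[OF ulW, of "{-M1..M1}"]
          compact_uniformly_continuous always_eventually) auto
    then show ?thesis by (simp add: W_def V'_def[abs_def])
  qed
  have cV: "continuous_on S (V n)" for S n unfolding V_def by (rule continuous_on_vel_snd)
  have ev: "\<forall>\<^sub>F n in sequentially. \<bar>a (r n) - a'\<bar> \<le> e \<and> (\<forall>t\<in>{0..T}. \<bar>V (r n) t - V' t\<bar> \<le> e)"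
    if "e > 0" for e
    using tendstoD[OF al that] uniform_limitD[OF ulV that]
    by eventually_elim (auto simp: dist_real_def intro: less_imp_le)
  have ulU: "uniform_limit {0..T} (\<lambda>n. U (r n)) U' sequentially"
  proof (rule uniform_limitI)
    fix e :: real assume e: "e > 0"
    define d where "d = e / (2 * (1 + T))"
    have d: "d > 0" "(1 + T) * d < e" using e T by (auto simp: d_def divide_less_eq algebra_simps add_pos_pos)
    show "\<forall>\<^sub>F n in sequentially. \<forall>t\<in>{0..T}. dist (U (r n) t) (U' t) < e"
      using ev[OF d(1)]
    proof eventually_elim
      case (elim n)
      then show ?case
        using primitive_diff_le[OF cV contV, of "a (r n)" a' d "r n"] d(2)
        by (force simp: U_def U'_def dist_real_def)
    qed
  qed
  have contU: "continuous_on {0..T} U'"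
    unfolding U'_def using contV
    by (intro continuous_intros indefinite_integral_continuous_1 integrable_continuous_real)
  \<comment> \<open>The delays are left general: \<open>T / Suc (r n)\<close> serves the equation,
    and 0 serves the boundary condition, whose integral is not delayed.\<close>
  have lim_int: "(\<lambda>n. integral {0..t} (g (r n) (h n))) \<longlonglongrightarrow> integral {0..t} (\<lambda>q. f q (U' q) (V' q))"
    if t: "t \<in> {0..T}" and h: "h \<longlonglongrightarrow> 0" "\<And>n. 0 \<le> h n" for t h
  proof (rule dominated_convergence(2)[where h = "\<lambda>_. M"])
    show "g (r n) (h n) integrable_on {0..t}" for n
      by (intro integrable_continuous_real contg)
    show "norm (g (r n) (h n) q) \<le> M" if "q \<in> {0..t}" for n q
      using bg[of q "h n"] that t h(2) by simp
    show "(\<lambda>n. g (r n) (h n) q) \<longlonglongrightarrow> f q (U' q) (V' q)" if q: "q \<in> {0..t}" for q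
    proof -
      define y where "y n = max 0 (q - h n)" for n
      have "(\<lambda>n. max 0 (q - h n)) \<longlonglongrightarrow> max 0 (q - 0)"
        by (intro tendsto_intros h)
      then have y: "y \<longlonglongrightarrow> q" using q by (simp add: y_def[abs_def])
      have yT: "y n \<in> {0..T}" "q \<in> {0..T}" for n using q t h(2)[of n] T by (auto simp: y_def)
      have "(\<lambda>n. fe q (U (r n) (y n)) (V (r n) (y n))) \<longlonglongrightarrow> fe q (U' q) (V' q)"
        by (intro tendsto_intros tendsto_uniform_limit_seq[OF ulU contU yT y]
            tendsto_uniform_limit_seq[OF ulV contV yT y])
      then show ?thesis using yT by (simp add: g_def y_def fe_def)
    qed
  qed (rule integrable_const_ivl)
  show thesis
  proof (rule that[OF r s02 sl contV])
    show "limitin (C1_topology T) (\<lambda>n. sol (r n) (p (r n))) (primitive_on T a' V') sequentially"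
      unfolding Metric_space.limitin_metric[OF C1_Metric_space[OF T]]
    proof (intro conjI allI impI)
      show "primitive_on T a' V' \<in> C1_space T" using primitive_on_C1(1)[OF T contV] .
      fix e :: real assume e: "e > 0"
      define d where "d = e / (2 * (2 + T))"
      have d: "d > 0" "(2 + T) * d < e" using e T by (auto simp: d_def divide_less_eq algebra_simps add_pos_pos)
      show "\<forall>\<^sub>F n in sequentially. sol (r n) (p (r n)) \<in> C1_space T \<and>
          C1_dist T (sol (r n) (p (r n))) (primitive_on T a' V') < e"
        using ev[OF d(1)]
      proof eventually_elim
        case (elim n)
        then have "C1_dist T (primitive_on T (a (r n)) (V (r n))) (primitive_on T a' V') \<le> (2 + T) * d"
          by (intro C1_dist_primitive_on T cV contV) auto
        then show ?case using d(2) sol_C1 by (auto simp: sol_def a_def V_def)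
      qed
    qed
    have "\<phi> (V' t) = \<phi> a'
       + max 0 (s - 1) * integral {0..t} (\<lambda>q. f q (a' + integral {0..q} V') (V' q))
       + (1 - \<bar>1 - s\<bar>) * t * B_fun \<phi> b a' / T" if t: "t \<in> {0..T}" for t
    proof (rule LIMSEQ_unique)
      show "(\<lambda>n. W (r n) t) \<longlonglongrightarrow> \<phi> (V' t)"
        using tendsto_uniform_limitI[OF ulW t] by (simp add: V'_def)
      have "(\<lambda>n. T / real (Suc (r n))) \<longlonglongrightarrow> 0"
        using LIMSEQ_subseq_LIMSEQ[OF lim_const_over_n[THEN LIMSEQ_Suc] r, of T]
        by (simp add: o_def)
      then have "(\<lambda>n. integral {0..t} (g (r n) (T / Suc (r n)))) \<longlonglongrightarrow>
          integral {0..t} (\<lambda>q. f q (U' q) (V' q))"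
        using T by (intro lim_int t) auto
      then show "(\<lambda>n. W (r n) t) \<longlonglongrightarrow> \<phi> a'
       + max 0 (s - 1) * integral {0..t} (\<lambda>q. f q (a' + integral {0..q} V') (V' q))
       + (1 - \<bar>1 - s\<bar>) * t * B_fun \<phi> b a' / T"
        unfolding Weq[OF t] U'_def by (intro tendsto_intros sl al) (use T in auto)
    qed
    then show "\<forall>t\<in>{0..T}. \<phi> (V' t) = \<phi> a'
       + max 0 (s - 1) * integral {0..t} (\<lambda>q. f q (a' + integral {0..q} V') (V' q))
       + (1 - \<bar>1 - s\<bar>) * t * B_fun \<phi> b a' / T" by blast
    have "(\<lambda>n. integral {0..T} (g (r n) 0)) \<longlonglongrightarrow> integral {0..T} (\<lambda>q. f q (U' q) (V' q))"
      using T by (intro lim_int) auto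
    then have "(\<lambda>n. 1 / T * integral {0..T} (g (r n) 0)) \<longlonglongrightarrow>
        1 / T * integral {0..T} (\<lambda>q. f q (U' q) (V' q))"
      by (intro tendsto_intros)
    moreover have "1 / T * integral {0..T} (g n 0) = B_fun \<phi> b (a n) / T" for n
    proof -
      have "integral {0..T} (g n 0) = integral {0..T} (\<lambda>t. fe t (U n t) (V n t))"
        by (intro integral_cong) (simp add: g_def)
      then show ?thesis
        using zero[of n] by (auto simp: bc_def vec_eq_iff forall_2 a_def V_def U_def)
    qed
    ultimately have "(\<lambda>n. B_fun \<phi> b (a (r n)) / T) \<longlonglongrightarrow> 1 / T * integral {0..T} (\<lambda>q. f q (U' q) (V' q))"
      by (simp only:)
    moreover have "(\<lambda>n. B_fun \<phi> b (a (r n)) / T) \<longlonglongrightarrow> B_fun \<phi> b a' / T"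
      by (intro tendsto_intros al) (use T in auto)
    ultimately show "B_fun \<phi> b a' / T = 1 / T * integral {0..T} (\<lambda>q. f q (a' + integral {0..q} V') (V' q))"
      unfolding U'_def using LIMSEQ_unique by blast
  qed
qed


section \<open>Limits as solutions of the original problems\<close>

lemma continuous_on_field:
  assumes "continuous_on {0..T} V"
  shows "continuous_on {0..T} (\<lambda>q. f q (a + integral {0..q} V) (V q))"
proof -
  have "continuous_on {0..T} (\<lambda>q. integral {0..q} V)"
    using assms by (intro indefinite_integral_continuous_1 integrable_continuous_real)
  then have "continuous_on {0..T} (\<lambda>q. fe q (a + integral {0..q} V) (V q))"
    using assms by (intro continuous_intros)
  then show ?thesis
    by (rule continuous_on_eq) (simp add: fe_def)
qed

lemma N_op_primitive_on:
  assumes "continuous_on {0..T} V" "t \<in> {0..T}"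
  shows "N_op T f (primitive_on T a V) t = f t (a + integral {0..t} V) (V t)"
  using assms primitive_on_C1(2)[OF T assms(1)] by (simp add: N_op_def primitive_on_def)

lemma Q_N_op_primitive_on:
  assumes "continuous_on {0..T} V" "t \<in> {0..T}"
  shows "Q_op T (N_op T f (primitive_on T a V)) t
    = 1 / T * integral {0..T} (\<lambda>q. f q (a + integral {0..q} V) (V q))"
proof -
  have "integral {0..T} (N_op T f (primitive_on T a V))
      = integral {0..T} (\<lambda>q. f q (a + integral {0..q} V) (V q))"
    by (intro integral_cong N_op_primitive_on assms(1))
  then show ?thesis using assms(2) by (simp add: Q_op_def)
qed

text \<open>The mean of \<open>N_op\<close> equals \<open>B_fun \<phi> b a / T\<close>, so the
  constant terms of \<open>Z_op\<close> reduce to \<open>a\<close>, and \<open>H_op\<close> is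
  applied to \<open>V\<close>.\<close>

lemma primitive_on_eq_Z_op:
  assumes V: "continuous_on {0..T} V"
    and eq: "\<And>t. t \<in> {0..T} \<Longrightarrow> \<phi> (V t) = \<phi> a + s * t * B_fun \<phi> b a / T"
    and B: "B_fun \<phi> b a / T = 1 / T * integral {0..T} (\<lambda>q. f q (a + integral {0..q} V) (V q))"
  shows "primitive_on T a V = Z_op T b \<phi> f s (primitive_on T a V)"
proof
  fix t
  let ?u = "primitive_on T a V"
  have u0: "?u 0 = a" using T by (simp add: primitive_on_def)
  show "?u t = Z_op T b \<phi> f s ?u t"
  proof (cases "t \<in> {0..T}")
    case True
    have "inv \<phi> (s * (q * B_fun \<phi> b a / T) + \<phi> a) = V q" if "q \<in> {0..T}" for q
    proof -
      have "s * (q * B_fun \<phi> b a / T) + \<phi> a = \<phi> (V q)"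
        using eq[OF that] by (simp add: mult.assoc)
      then show ?thesis by simp
    qed
    then have "integral {0..t} (\<lambda>q\<in>{0..T}. inv \<phi> (s * (q * B_fun \<phi> b (P_op T ?u q) / T) + \<phi> (P_op T ?u q)))
        = integral {0..t} V"
      using True by (intro integral_cong) (auto simp: P_op_def u0)
    moreover have "Q_op T (N_op T f ?u) t = B_fun \<phi> b a / T"
      unfolding B by (rule Q_N_op_primitive_on[OF V True])
    moreover have "?u t = a + integral {0..t} V"
      using True by (simp add: primitive_on_def)
    moreover have "P_op T ?u t = a" using True by (simp add: P_op_def u0)
    ultimately show ?thesis
      using True unfolding Z_op_def H_op_def by simp
  next
    case False
    then show ?thesis
      by (simp only: Z_op_def primitive_on_def restrict_def if_False)
  qed
qed

text \<open>Since \<open>B_fun \<phi> b a / T\<close> is the mean of \<open>N_op\<close>,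
  differentiating the momentum gives the equation. At time \<open>T\<close> the two weighted terms
  add up to \<open>B_fun \<phi> b a\<close>, hence
  \<open>\<phi> (V T) = \<phi> (b * a)\<close>.\<close>

lemma primitive_on_bvp_solution:
  assumes V: "continuous_on {0..T} V"
    and eq: "\<And>t. t \<in> {0..T} \<Longrightarrow> \<phi> (V t) = \<phi> a
       + lam * integral {0..t} (\<lambda>q. f q (a + integral {0..q} V) (V q))
       + (1 - lam) * t * B_fun \<phi> b a / T"
    and B: "B_fun \<phi> b a / T = 1 / T * integral {0..T} (\<lambda>q. f q (a + integral {0..q} V) (V q))"
  shows "bvp_solution T b \<phi> (\<lambda>u t. lam * N_op T f u t + (1 - lam) * Q_op T (N_op T f u) t)
    (primitive_on T a V)"
proof -
  let ?u = "primitive_on T a V"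
  define g where "g q = f q (a + integral {0..q} V) (V q)" for q
  define W where "W t = lam * g t + (1 - lam) * (B_fun \<phi> b a / T)" for t
  have contg: "continuous_on {0..T} g"
    unfolding g_def by (rule continuous_on_field[OF V])
  then have contW: "continuous_on {0..T} W"
    unfolding W_def by (intro continuous_intros)
  have du: "deriv_on T ?u t = V t" if "t \<in> {0..T}" for t
    by (rule primitive_on_C1(2)[OF T V that])
  have mom: "(\<lambda>t\<in>{0..T}. \<phi> (deriv_on T ?u t)) = primitive_on T (\<phi> a) W"
  proof
    fix t
    show "(\<lambda>t\<in>{0..T}. \<phi> (deriv_on T ?u t)) t = primitive_on T (\<phi> a) W t"
    proof (cases "t \<in> {0..T}")
      case True
      have "g integrable_on {0..t}"
        using True by (intro integrable_continuous_real continuous_on_subset[OF contg]) auto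
      then have "integral {0..t} W = lam * integral {0..t} g + (1 - lam) * (B_fun \<phi> b a / T) * t"
        unfolding W_def using True by (subst integral_add) (auto intro: integrable_on_mult_right)
      then have "\<phi> (V t) = \<phi> a + integral {0..t} W"
        unfolding eq[OF True] g_def by (simp add: algebra_simps)
      then show ?thesis
        using True du[OF True] by (simp add: primitive_on_def[of T "\<phi> a"])
    next
      case False
      then show ?thesis
        by (simp only: primitive_on_def restrict_def if_False)
    qed
  qed
  have V0: "V 0 = a"
    using arg_cong[OF eq[of 0], of "inv \<phi>"] T by simp
  have Tin: "T \<in> {0..T}" using T by simp
  have I: "integral {0..T} (\<lambda>q. f q (a + integral {0..q} V) (V q)) = B_fun \<phi> b a"
    using arg_cong[OF B, of "\<lambda>x. T * x"] T by simp
  have c: "(1 - lam) * T * B_fun \<phi> b a / T = (1 - lam) * B_fun \<phi> b a"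
    using T by simp
  have "\<phi> (V T) = \<phi> (b * a)"
    unfolding eq[OF Tin] I c by (simp add: B_fun_def algebra_simps)
  from arg_cong[OF this, of "inv \<phi>"] have VT: "V T = b * a" by simp
  show ?thesis
    unfolding bvp_solution_def mom
  proof (intro conjI ballI)
    show "?u \<in> C1_space T" by (rule primitive_on_C1(1)[OF T V])
    show "primitive_on T (\<phi> a) W \<in> C1_space T" by (rule primitive_on_C1(1)[OF T contW])
    show "deriv_on T (primitive_on T (\<phi> a) W) t
        = lam * N_op T f ?u t + (1 - lam) * Q_op T (N_op T f ?u) t" if "t \<in> {0..T}" for t
      unfolding primitive_on_C1(2)[OF T contW that] N_op_primitive_on[OF V that]
        Q_N_op_primitive_on[OF V that] W_def g_def B ..
    show "deriv_on T ?u 0 = ?u 0" "deriv_on T ?u T = b * deriv_on T ?u 0"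
      using T by (simp_all add: du V0 VT) (simp add: primitive_on_def)
  qed
qed

end

section \<open>The homotopy argument\<close>

theorem theorem4p1:
  fixes T b :: real
    and \<phi> :: "real \<Rightarrow> real"
    and f :: "real \<Rightarrow> real \<Rightarrow> real \<Rightarrow> real"
    and \<Omega> :: "(real \<Rightarrow> real) set"
  assumes "T > 0" and "b \<noteq> 0"
    and "homeomorphism UNIV UNIV \<phi> (inv \<phi>)" and "\<phi> 0 = 0"
    and "continuous_on ({0..T} \<times> UNIV \<times> UNIV) (\<lambda>(t, x, y). f t x y)"
    and "openin (C1_topology T) \<Omega>" and "C1_bounded T \<Omega>"
    and "\<And>lam u. \<lbrakk>lam \<in> {0..1}; u \<in> C1_space T; u = Z_op T b \<phi> f lam u\<rbrakk>
           \<Longrightarrow> u \<notin> C1_topology T frontier_of \<Omega>"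
    and "Brouwer_deg (G_map T b \<phi> f) (affine_slice T \<Omega>) 0 \<noteq> 0"
    and "\<And>lam. lam \<in> {0<..1} \<Longrightarrow>
           \<not> (\<exists>u \<in> C1_topology T frontier_of \<Omega>.
                bvp_solution T b \<phi>
                  (\<lambda>u t. lam * N_op T f u t + (1 - lam) * Q_op T (N_op T f u) t) u)"
  shows "\<exists>u. bvp_solution T b \<phi> (N_op T f) u"
proof (rule ccontr)
  assume no_sol: "\<nexists>u. bvp_solution T b \<phi> (N_op T f) u"
  interpret delay_family T b \<phi> f
    using assms(1,3,5) by unfold_locales
  interpret M: Metric_space "C1_space T" "C1_dist T" by (rule C1_Metric_space[OF T])
  define cl where "cl = C1_topology T closure_of \<Omega>"
  define fr where "fr = C1_topology T frontier_of \<Omega>"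
  have closed_cl: "closedin (C1_topology T) cl" and closed_fr: "closedin (C1_topology T) fr"
    by (simp_all add: cl_def fr_def closedin_frontier_of)
  have fr_eq: "fr = cl - \<Omega>"
    using assms(6) by (simp add: fr_def cl_def frontier_of_def interior_of_openin)
  have Om_cl: "\<Omega> \<subseteq> cl"
    unfolding cl_def using assms(6) openin_subset by (intro closure_of_subset) blast
  obtain R where R: "\<And>u t. u \<in> cl \<Longrightarrow> t \<in> {0..T} \<Longrightarrow> \<bar>u t\<bar> \<le> R \<and> \<bar>deriv_on T u t\<bar> \<le> R"
    using C1_bounded_imp[OF T M.mbounded_closure_of[OF assms(7)]] unfolding cl_def by blast
  \<comment> \<open>Up to \<open>s = 1\<close> this is the hypothesis on \<open>Z_op\<close> with
    \<open>lam = s\<close>; beyond, it is the hypothesis on the boundary value problems with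
    \<open>lam = s - 1\<close>.\<close>
  have no_fr: "u \<notin> fr"
    if s: "s \<in> {0..2}" and V: "continuous_on {0..T} V" and u: "u = primitive_on T a V"
      and eq: "\<And>t. t \<in> {0..T} \<Longrightarrow> \<phi> (V t) = \<phi> a
       + max 0 (s - 1) * integral {0..t} (\<lambda>q. f q (a + integral {0..q} V) (V q))
       + (1 - \<bar>1 - s\<bar>) * t * B_fun \<phi> b a / T"
      and B: "B_fun \<phi> b a / T = 1 / T * integral {0..T} (\<lambda>q. f q (a + integral {0..q} V) (V q))"
    for s a V u
  proof (cases "s \<le> 1")
    case True
    then have "u = Z_op T b \<phi> f s u"
      unfolding u using eq s by (intro primitive_on_eq_Z_op V B) simp
    then show ?thesis
      using assms(8)[of s u] True s primitive_on_C1(1)[OF T V] by (simp add: u fr_def)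
  next
    case False
    then have "bvp_solution T b \<phi>
        (\<lambda>u t. (s - 1) * N_op T f u t + (1 - (s - 1)) * Q_op T (N_op T f u) t) u"
      unfolding u using eq s by (intro primitive_on_bvp_solution V B) simp
    then show ?thesis
      using assms(10)[of "s - 1"] False s by (auto simp: fr_def)
  qed
  \<comment> \<open>Some delay is short enough to exclude zeros on the boundary at every parameter
    and zeros in the closure at parameter 2. Otherwise there is a bad point for each delay, and a
    subsequence of their solutions converges.\<close>
  have "\<exists>n. \<forall>p. fst p \<in> {0..2} \<and> sol n p \<in> cl \<and> bc n (fst p) (snd p) = 0
      \<longrightarrow> sol n p \<notin> fr \<and> fst p \<noteq> 2"
  proof (rule ccontr)
    assume "\<not> ?thesis"
    then have "\<forall>n. \<exists>p. fst p \<in> {0..2} \<and> sol n p \<in> cl \<and> bc n (fst p) (snd p) = 0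
      \<and> (sol n p \<in> fr \<or> fst p = 2)" by blast
    then obtain p where p: "\<And>n. fst (p n) \<in> {0..2}" "\<And>n. sol n (p n) \<in> cl"
        "\<And>n. bc n (fst (p n)) (snd (p n)) = 0" "\<And>n. sol n (p n) \<in> fr \<or> fst (p n) = 2"
      by metis
    have bounds: "\<bar>sol n (p n) t\<bar> \<le> R" "\<bar>vel n (p n) t\<bar> \<le> R" if "t \<in> {0..T}" for n t
      using R[OF p(2) that, of n] deriv_sol[OF that, of n "p n"] by auto
    obtain r s a V where rs: "strict_mono r" "s \<in> {0..2}" "(\<lambda>n. fst (p (r n))) \<longlonglongrightarrow> s"
      and V: "continuous_on {0..T} V"
      and lim: "limitin (C1_topology T) (\<lambda>n. sol (r n) (p (r n))) (primitive_on T a V) sequentially"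
      and eq: "\<forall>t\<in>{0..T}. \<phi> (V t) = \<phi> a
       + max 0 (s - 1) * integral {0..t} (\<lambda>q. f q (a + integral {0..q} V) (V q))
       + (1 - \<bar>1 - s\<bar>) * t * B_fun \<phi> b a / T"
      and B: "B_fun \<phi> b a / T = 1 / T * integral {0..T} (\<lambda>q. f q (a + integral {0..q} V) (V q))"
      by (rule delay_limit[OF p(1) bounds p(3)])
    let ?u = "primitive_on T a V"
    have "?u \<notin> fr" using no_fr[OF rs(2) V refl eq[rule_format] B] .
    then have "?u \<in> C1_space T - fr"
      using primitive_on_C1(1)[OF T V] by simp
    moreover have "openin (C1_topology T) (C1_space T - fr)"
      using closed_fr by (simp add: closedin_def)
    \<comment> \<open>The limit is off the closed frontier, so eventually only the alternative of
      parameter 2 remains; the limit then solves the problem assumed to be unsolvable.\<close>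
    ultimately have "\<forall>\<^sub>F n in sequentially. sol (r n) (p (r n)) \<in> C1_space T - fr"
      by (rule limitinD[OF lim, rotated])
    then have "\<forall>\<^sub>F n in sequentially. fst (p (r n)) = 2"
      by (rule eventually_mono) (use p(4) in blast)
    then have "(\<lambda>n. fst (p (r n))) \<longlonglongrightarrow> 2"
      by (rule tendsto_eventually)
    then have s2: "s = 2" using rs(3) LIMSEQ_unique by blast
    have "bvp_solution T b \<phi> (\<lambda>u t. 1 * N_op T f u t + (1 - 1) * Q_op T (N_op T f u) t) ?u"
      using eq by (intro primitive_on_bvp_solution V B) (simp add: s2)
    then show False using no_sol by simp
  qed
  then obtain n where n: "\<And>p. fst p \<in> {0..2} \<Longrightarrow> sol n p \<in> cl \<Longrightarrow> bc n (fst p) (snd p) = 0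
      \<Longrightarrow> sol n p \<notin> fr \<and> fst p \<noteq> 2" by blast
  define W where "W = {p. sol n p \<in> \<Omega>}"
  define K where "K = {p. sol n p \<in> cl}"
  have W: "open W" unfolding W_def by (rule open_sol_vimage[OF assms(6)])
  have K: "closed K" unfolding K_def by (rule closed_sol_vimage[OF closed_cl])
  have WK: "W \<subseteq> K" using Om_cl by (auto simp: W_def K_def)
  have bounded_K: "bounded (K \<inter> {0..2} \<times> UNIV)"
  proof (rule bounded_subset)
    \<comment> \<open>The planar norm is at most the sum of the absolute values of the initial
      position and velocity, each bounded by \<open>R\<close>.\<close>
    show "bounded ({0..2::real} \<times> cball (0::real^2) (R + R))" by (intro bounded_Times) auto
    show "K \<inter> {0..2} \<times> UNIV \<subseteq> {0..2} \<times> cball 0 (R + R)"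
    proof
      fix p assume p: "p \<in> K \<inter> {0..2} \<times> UNIV"
      then have "sol n p \<in> cl" by (simp add: K_def)
      then have "\<bar>sol n p 0\<bar> \<le> R" "\<bar>deriv_on T (sol n p) 0\<bar> \<le> R"
        using R[of "sol n p" 0] T by auto
      moreover have "sol n p 0 = snd p $ 1" "deriv_on T (sol n p) 0 = snd p $ 2"
        using T deriv_sol[of 0 n p] vel_at_0 by (auto simp: sol_def primitive_on_def)
      ultimately have "norm (snd p) \<le> R + R"
        using norm_le_l1_cart[of "snd p"] by (simp add: sum_2)
      then show "p \<in> {0..2} \<times> cball 0 (R + R)" using p by (auto simp: mem_Times_iff)
    qed
  qed
  \<comment> \<open>This carries the degree of \<open>G_map\<close> on the affine slice from
    parameter 0 to parameter 2.\<close>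
  have "Brouwer_deg (bc n 0) {v. (0, v) \<in> W} 0 = Brouwer_deg (bc n 2) {v. (2, v) \<in> W} 0"
  proof (rule Brouwer_deg_homotopy[OF refl _ _ continuous_on_bc W WK K bounded_K])
    show "(s, v) \<in> W" if "s \<in> {0..2}" "(s, v) \<in> K" "bc n s v = 0" for s v
      using n[of "(s, v)"] that by (auto simp: W_def K_def fr_eq)
  qed auto
  moreover have "{v. (0, v) \<in> W} = affine_slice T \<Omega>"
    by (simp add: W_def affine_slice_def sol_0)
  ultimately have deg: "Brouwer_deg (bc n 2) {v. (2, v) \<in> W} 0 \<noteq> 0"
    using assms(9) by (simp add: bc_0)
  let ?D = "{v. (2, v) \<in> W}"
  have "?D = (\<lambda>v. (2, v)) -` W" "{v. (2, v) \<in> K} = (\<lambda>v. (2, v)) -` K" by auto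
  then have openD: "open ?D" and closedK: "closed {v. (2, v) \<in> K}"
    using W K by (auto intro!: open_vimage closed_vimage continuous_intros)
  have "bounded ?D"
  proof (rule bounded_subset)
    show "bounded (snd ` (K \<inter> {0..2} \<times> UNIV))" using bounded_K by (rule bounded_snd)
    show "?D \<subseteq> snd ` (K \<inter> {0..2} \<times> UNIV)" using WK by force
  qed
  moreover have "continuous_on (closure ?D) (bc n 2)"
    using continuous_on_compose2[OF continuous_on_bc, of "closure ?D" "\<lambda>v. (2, v)"]
    by (simp add: continuous_intros)
  \<comment> \<open>The nonzero degree produces a zero in the closure at parameter 2, against the
    choice of \<open>n\<close>.\<close>
  ultimately obtain v where v: "v \<in> closure ?D" "bc n 2 v = 0"
    using Brouwer_deg_nonzero_imp_zero[OF openD _ _ deg] by blast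
  have "closure ?D \<subseteq> {v. (2, v) \<in> K}"
    using WK closedK by (intro closure_minimal) auto
  then show False using n[of "(2, v)"] v by (auto simp: K_def)
qed

end
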